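(* Let $1<q<\infty$, let $q'=q/(q-1)$, and let $w$ be a weight whose primitive sequence $\sigma=(s_n)_{n=1}^\infty$ has both the URP and the LRP. Then $(d_{1,q}(w))^*=d_{1,q'}(w^* )$, where $w^*$ is a weight whose primitive sequence is equivalent to the dual sequence $\sigma^*=(n/s_n)_{n=1}^\infty$.
   Context: A weight is a sequence $w=(w_n)_{n=1}^\infty$ of non-negative scalars with $w_1>0$; its primitive sequence is $\sigma=(s_m)_{m=1}^\infty$, $s_m=\sum_{n=1}^m w_n$. For $0<q<\infty$ and $f\in c_0$ with non-increasing rearrangement $f^*=(a_n)_{n=1}^\infty$ of $|f|$, put $\|f\|_{1,q,w}=\left(\sum_{n=1}^\infty (a_ns_n)^q\frac{w_n}{s_n}\right)^{1/q}$ and $d_{1,q}(w)=\{f\in c_0:\|f\|_{1,q,w}<\infty\}$. A sequence $(t_n)_{n=1}^\infty$ of positive scalars has the URP (upper regularity property) if there is an integer $b\ge2$ with $t_{bn}\le\frac b2t_n$ for all $n\in\mathbb{N}$, and the LRP (lower regularity property) if there is an integer $b\ge2$ with $2t_n\le t_{bn}$ for all $n\in\mathbb{N}$. Two sequences of positive scalars are equivalent if their ratio is bounded above and bounded away from zero. The equality of the dual space with a sequence space means that, under the natural pairing $\langle (a_n),(b_n)\rangle=\sum_n a_nb_n$, the two spaces coincide with equivalent (quasi-)norms. *)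

theory Defs
  imports Complex_Main "HOL-Library.FuncSet"
begin

text \<open>
  Entries of weights, vectors and rearrangements are indexed from 0, so that \<open>w n\<close> is the
  mathematical $w_{n+1}$.  Primitive sequences and the sequences derived from them keep
  their usual indices $m \geq 1$; their value at 0 is never used.  The scalars form a type of
  class \<open>real_normed_field\<close> and \<open>banach\<close>, which covers both the real and the complex case.
\<close>

definition weight :: "(nat \<Rightarrow> real) \<Rightarrow> bool" where
  "weight w \<longleftrightarrow> (\<forall>n. 0 \<le> w n) \<and> 0 < w 0"

definition primitive :: "(nat \<Rightarrow> real) \<Rightarrow> nat \<Rightarrow> real" where
  "primitive w m = (\<Sum>n<m. w n)"

definition dual_seq :: "(nat \<Rightarrow> real) \<Rightarrow> nat \<Rightarrow> real" where
  "dual_seq s n = real n / s n"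

definition URP :: "(nat \<Rightarrow> real) \<Rightarrow> bool" where
  "URP t \<longleftrightarrow> (\<exists>b\<ge>2. \<forall>n\<ge>1. t (b * n) \<le> real b / 2 * t n)"

definition LRP :: "(nat \<Rightarrow> real) \<Rightarrow> bool" where
  "LRP t \<longleftrightarrow> (\<exists>b::nat\<ge>2. \<forall>n\<ge>1. 2 * t n \<le> t (b * n))"

definition equivalent_seq :: "(nat \<Rightarrow> real) \<Rightarrow> (nat \<Rightarrow> real) \<Rightarrow> bool" where
  "equivalent_seq s t \<longleftrightarrow> (\<exists>c>0. \<exists>C. \<forall>n\<ge>1. c \<le> s n / t n \<and> s n / t n \<le> C)"

definition c0 :: "(nat \<Rightarrow> 'a::real_normed_vector) set" where
  "c0 = {f. f \<longlonglongrightarrow> 0}"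

text \<open>
  The \<open>n\<close>-th largest absolute value (counted from 0, with multiplicity), obtained from the
  distribution function.  The finiteness condition is needed because \<open>card\<close> is 0 on
  infinite sets.
\<close>

definition decreasing_rearrangement :: "(nat \<Rightarrow> 'a::real_normed_vector) \<Rightarrow> nat \<Rightarrow> real" where
  "decreasing_rearrangement f n =
     Inf {t. 0 \<le> t \<and> finite {k. t < norm (f k)} \<and> card {k. t < norm (f k)} \<le> n}"

definition lorentz_term ::
  "real \<Rightarrow> (nat \<Rightarrow> real) \<Rightarrow> (nat \<Rightarrow> 'a::real_normed_vector) \<Rightarrow> nat \<Rightarrow> real" where
  "lorentz_term q w f n =
     (decreasing_rearrangement f n * primitive w (Suc n)) powr q * (w n / primitive w (Suc n))"

text \<open>The real-valued \<open>lorentz_norm\<close> is meaningful only on \<open>lorentz_space\<close>: a divergent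
  series, for which the mathematical value is infinite, has an unspecified \<open>suminf\<close>.\<close>

definition lorentz_norm ::
  "real \<Rightarrow> (nat \<Rightarrow> real) \<Rightarrow> (nat \<Rightarrow> 'a::real_normed_vector) \<Rightarrow> real" where
  "lorentz_norm q w f = (\<Sum>n. lorentz_term q w f n) powr (1 / q)"

definition lorentz_space ::
  "real \<Rightarrow> (nat \<Rightarrow> real) \<Rightarrow> (nat \<Rightarrow> 'a::real_normed_vector) set" where
  "lorentz_space q w = {f \<in> c0. summable (lorentz_term q w f)}"

text \<open>
  The topological dual of a sequence space \<open>X\<close> with quasi-norm \<open>N\<close>.  Functionals are made
  \<open>extensional\<close> so that equality of functions is equality on \<open>X\<close>.
\<close>

definition dual_space ::
  "(nat \<Rightarrow> 'a::real_normed_field) set \<Rightarrow> ((nat \<Rightarrow> 'a) \<Rightarrow> real) \<Rightarrow> ((nat \<Rightarrow> 'a) \<Rightarrow> 'a) set" where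
  "dual_space X N = {\<phi> \<in> extensional X.
     (\<forall>f\<in>X. \<forall>g\<in>X. \<phi> (\<lambda>n. f n + g n) = \<phi> f + \<phi> g) \<and>
     (\<forall>c. \<forall>f\<in>X. \<phi> (\<lambda>n. c * f n) = c * \<phi> f) \<and>
     (\<exists>C. \<forall>f\<in>X. norm (\<phi> f) \<le> C * N f)}"

definition dual_norm ::
  "(nat \<Rightarrow> 'a::real_normed_field) set \<Rightarrow> ((nat \<Rightarrow> 'a) \<Rightarrow> real) \<Rightarrow> ((nat \<Rightarrow> 'a) \<Rightarrow> 'a) \<Rightarrow> real" where
  "dual_norm X N \<phi> = (SUP f\<in>{f \<in> X. N f \<le> 1}. norm (\<phi> f))"

definition pairing_functional ::
  "(nat \<Rightarrow> 'a::real_normed_field) set \<Rightarrow> (nat \<Rightarrow> 'a) \<Rightarrow> (nat \<Rightarrow> 'a) \<Rightarrow> 'a" where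
  "pairing_functional X g = (\<lambda>f\<in>X. \<Sum>n. f n * g n)"

text \<open>The dual of \<open>(X, N)\<close> is \<open>(Y, M)\<close> under the natural pairing, with equivalent norms.\<close>

definition dual_is ::
  "(nat \<Rightarrow> 'a::real_normed_field) set \<Rightarrow> ((nat \<Rightarrow> 'a) \<Rightarrow> real) \<Rightarrow>
   (nat \<Rightarrow> 'a) set \<Rightarrow> ((nat \<Rightarrow> 'a) \<Rightarrow> real) \<Rightarrow> bool" where
  "dual_is X N Y M \<longleftrightarrow>
     (\<forall>g\<in>Y. \<forall>f\<in>X. summable (\<lambda>n. f n * g n)) \<and>
     bij_betw (pairing_functional X) Y (dual_space X N) \<and>
     (\<exists>c>0. \<exists>C>0. \<forall>g\<in>Y. c * M g \<le> dual_norm X N (pairing_functional X g) \<and>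
                        dual_norm X N (pairing_functional X g) \<le> C * M g)"

end

(* LRP and URP make it possible to choose a base B such that the values of both primitive
   sequences at B^j grow by a factor between 2 and a constant from one j to the next.  With
   S_j the primitive sequence of w at B^j, the Lorentz norm is then equivalent to the l^q
   norm of the sequence f*(B^j) S_j, and likewise for w', whose values S'_j satisfy
   S_j S'_j ~ B^j.  Boundedness of the pairing follows from the rearrangement inequality and
   Hoelder's inequality for the dyadic sequences.  Conversely, testing a bounded functional
   on suitable decreasing step vectors, placed along an enumeration of its coefficients g by
   decreasing modulus, bounds the dyadic l^q' norm of g; the same test along infinitely many
   coefficients of modulus >= e shows beforehand that g tends to 0. *)

theory Submission
  imports Defs "HOL-Analysis.Convex" "HOL-Analysis.Uniform_Limit"
begin

text \<open>Entries of \<open>w\<close> may oscillate and even vanish, so \<open>w n\<close> cannot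
  be compared with s_n / n; only block masses are controlled. Growth by a factor of at least 2 makes
  the \<open>w\<close>-mass of the block from B^j to B^(j+1) at least S_j, and bounded growth makes
  it at most a multiple of S_j. Each block sum of the Lorentz norm thus lies between multiples of
  neighbouring dyadic terms. LRP gives the growth of S_j. That of S'_j comes from URP: s_(bn) <=
  (b/2) s_n says that n/s_n at least doubles from n to bn, and iterating it beats the constants lost
  between the dual sequence and the primitive sequence of \<open>w'\<close>. Rearrangements are not
  subadditive, so no triangle inequality for the Lorentz quasi-norm is invoked: closure under
  addition goes through dyadic sums, and the test vectors are l^q-combinations, whose q-th powers
  simply add up. Existence of \<open>w'\<close> is a separate matter, since n/s_n need not be
  non-decreasing while every primitive sequence is.\<close>

section \<open>Non-increasing rearrangements\<close>

abbreviation dr where "dr \<equiv> decreasing_rearrangement"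

lemma c0_finite_greater:
  assumes "f \<in> c0" "0 < t"
  shows "finite {k. t \<le> norm (f k)}"
proof -
  from assms have "eventually (\<lambda>k. norm (f k) < t) sequentially"
    by (auto simp: c0_def tendsto_iff)
  then obtain N where "\<And>k. k \<ge> N \<Longrightarrow> norm (f k) < t"
    by (auto simp: eventually_sequentially)
  then have "{k. t \<le> norm (f k)} \<subseteq> {..<N}"
    by (auto simp: not_less[symmetric])
  then show ?thesis
    by (rule finite_subset) simp
qed

lemma c0_finite_support:
  assumes "finite {k. f k \<noteq> 0}"
  shows "f \<in> c0"
proof -
  from assms obtain N where N: "{k. f k \<noteq> 0} \<subseteq> {..<N}"
    using finite_nat_iff_bounded by blast
  have "eventually (\<lambda>k. f k = 0) sequentially"
    unfolding eventually_sequentially using N by (intro exI[of _ N]) auto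
  then show ?thesis
    by (auto simp: c0_def intro: tendsto_eventually)
qed

lemma c0_bound:
  assumes "f \<in> c0"
  shows "\<exists>M>0. \<forall>k. norm (f k) \<le> M"
proof -
  have "convergent f"
    using assms by (auto simp: c0_def convergent_def)
  then have "Bseq f"
    by (rule convergent_imp_Bseq)
  then show ?thesis
    by (auto simp: Bseq_def)
qed

lemma dr_le:
  assumes "0 \<le> t" "finite {k. t < norm (f k)}" "card {k. t < norm (f k)} \<le> n"
  shows "dr f n \<le> t"
  unfolding decreasing_rearrangement_def
  using assms by (intro cInf_lower) (auto intro: bdd_belowI[of _ 0])

text \<open>\<open>Inf\<close> of a set of reals carries information only if the set is non-empty
  and bounded below; a bound for \<open>f\<close> is an admissible level for every
  \<open>n\<close>.\<close>

lemma dr_witness: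
  assumes "f \<in> c0"
  shows "\<exists>t\<ge>0. finite {k. t < norm (f k)} \<and> card {k. t < norm (f k)} \<le> n"
proof -
  obtain M where "0 < M" "\<forall>k. norm (f k) \<le> M"
    using c0_bound[OF assms] by auto
  then have "{k. M < norm (f k)} = {}"
    by (auto simp: not_less)
  with \<open>0 < M\<close> show ?thesis
    by (intro exI[of _ M]) (auto simp: \<open>{k. M < norm (f k)} = {}\<close>)
qed

lemma dr_greatest:
  assumes "f \<in> c0"
    and "\<And>t. 0 \<le> t \<Longrightarrow> finite {k. t < norm (f k)} \<Longrightarrow> card {k. t < norm (f k)} \<le> n \<Longrightarrow> y \<le> t"
  shows "y \<le> dr f n"
  unfolding decreasing_rearrangement_def
  using dr_witness[OF assms(1), of n] assms(2) by (intro cInf_greatest) auto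

lemma dr_nonneg: "f \<in> c0 \<Longrightarrow> 0 \<le> dr f n"
  by (rule dr_greatest)

lemma dr_antimono:
  assumes "f \<in> c0" "m \<le> n"
  shows "dr f n \<le> dr f m"
  using assms by (intro dr_greatest[OF assms(1)] dr_le) auto

lemma dr_mono:
  assumes "g \<in> c0" "\<And>k. norm (f k) \<le> norm (g k)"
  shows "dr f n \<le> dr g n"
proof (rule dr_greatest[OF assms(1)])
  fix t :: real
  assume t: "0 \<le> t" "finite {k. t < norm (g k)}" "card {k. t < norm (g k)} \<le> n"
  have sub: "{k. t < norm (f k)} \<subseteq> {k. t < norm (g k)}"
    using assms(2) by (auto intro: less_le_trans)
  show "dr f n \<le> t"
    using t finite_subset[OF sub t(2)] card_mono[OF t(2) sub] by (intro dr_le) auto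
qed

lemma dr_le_of_norm_le:
  assumes "0 \<le> t" "\<And>k. norm (f k) \<le> t"
  shows "dr f n \<le> t"
proof -
  have "{k. t < norm (f k)} = {}"
    using assms(2) by (auto simp: not_less)
  then show ?thesis
    using assms(1) by (intro dr_le) auto
qed

text \<open>An entry exceeding \<open>x n\<close> sits at some \<open>\<pi> m\<close> with
  \<open>x m > x n\<close>, so \<open>m < n\<close>, and there are at most \<open>n\<close> such
  positions. This serves both the greedy enumeration and the test vectors.\<close>

lemma dr_le_of_enumeration:
  fixes \<pi> :: "nat \<Rightarrow> nat"
  assumes "antimono x" "\<And>n. 0 \<le> x n" "\<And>n. norm (f (\<pi> n)) \<le> x n"
    and "\<And>k. k \<notin> range \<pi> \<Longrightarrow> f k = 0"
  shows "dr f n \<le> x n"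
proof -
  have sub: "{k. x n < norm (f k)} \<subseteq> \<pi> ` {..<n}"
  proof
    fix k assume k: "k \<in> {k. x n < norm (f k)}"
    then have "f k \<noteq> 0"
      using assms(2)[of n] by auto
    then obtain m where m: "k = \<pi> m"
      using assms(4) by auto
    then have "x n < x m"
      using k assms(3)[of m] by auto
    then have "m < n"
      using antimonoD[OF assms(1), of n m] by (cases "m < n") auto
    then show "k \<in> \<pi> ` {..<n}"
      using m by auto
  qed
  have "card {k. x n < norm (f k)} \<le> n"
    using card_mono[OF _ sub] card_image_le[of "{..<n}" \<pi>] by simp
  then show ?thesis
    using finite_subset[OF sub] assms(2) by (intro dr_le) auto
qed

lemma dr_scale_le:
  fixes f :: "nat \<Rightarrow> 'a::real_normed_div_algebra"
  assumes "f \<in> c0"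
  shows "dr (\<lambda>k. c * f k) n \<le> norm c * dr f n"
proof (cases "c = 0")
  case True
  then show ?thesis by (auto intro: dr_le_of_norm_le)
next
  case False
  have "dr (\<lambda>k. c * f k) n / norm c \<le> dr f n"
  proof (rule dr_greatest[OF assms])
    fix t :: real
    assume t: "0 \<le> t" "finite {k. t < norm (f k)}" "card {k. t < norm (f k)} \<le> n"
    have eq: "{k. norm c * t < norm (c * f k)} = {k. t < norm (f k)}"
      using False by (auto simp: norm_mult)
    have "dr (\<lambda>k. c * f k) n \<le> norm c * t"
      using t by (intro dr_le) (auto simp: eq)
    then show "dr (\<lambda>k. c * f k) n / norm c \<le> t"
      using False by (simp add: field_simps)
  qed
  then show ?thesis
    using False by (simp add: field_simps)
qed

lemma c0_scale:
  fixes f :: "nat \<Rightarrow> 'a::real_normed_field"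
  shows "f \<in> c0 \<Longrightarrow> (\<lambda>k. c * f k) \<in> c0"
  by (auto simp: c0_def intro: tendsto_mult_right_zero)

lemma c0_add: "f \<in> c0 \<Longrightarrow> g \<in> c0 \<Longrightarrow> (\<lambda>k. f k + g k) \<in> c0"
  by (auto simp: c0_def intro: tendsto_add_zero)

lemma dr_scale:
  fixes f :: "nat \<Rightarrow> 'a::real_normed_field"
  assumes "f \<in> c0"
  shows "dr (\<lambda>k. c * f k) n = norm c * dr f n"
proof (cases "c = 0")
  case True
  have "(\<lambda>k::nat. 0::'a) \<in> c0" by (simp add: c0_def)
  then show ?thesis
    using dr_scale_le[OF assms, of c n] dr_nonneg[of "\<lambda>k::nat. 0::'a" n] True by simp
next
  case False
  have "(\<lambda>k. inverse c * (c * f k)) = f"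
    using False by (auto simp: field_simps)
  then have "dr f n \<le> inverse (norm c) * dr (\<lambda>k. c * f k) n"
    using dr_scale_le[OF c0_scale[OF assms, of c], of "inverse c" n] by (simp add: norm_inverse)
  then have "norm c * dr f n \<le> dr (\<lambda>k. c * f k) n"
    using False by (simp add: field_simps)
  then show ?thesis
    using dr_scale_le[OF assms, of c n] by simp
qed

text \<open>If |f + g| exceeds s + t at some index, then |f| exceeds s or |g| exceeds t there. The
  two infima are taken one after the other.\<close>

lemma dr_add_le:
  assumes "f \<in> c0" "g \<in> c0"
  shows "dr (\<lambda>k. f k + g k) (m + n) \<le> dr f m + dr g n"
proof -
  have "dr (\<lambda>k. f k + g k) (m + n) - dr g n \<le> dr f m"
  proof (rule dr_greatest[OF assms(1)])
    fix s :: real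
    assume s: "0 \<le> s" "finite {k. s < norm (f k)}" "card {k. s < norm (f k)} \<le> m"
    have "dr (\<lambda>k. f k + g k) (m + n) - s \<le> dr g n"
    proof (rule dr_greatest[OF assms(2)])
      fix t :: real
      assume t: "0 \<le> t" "finite {k. t < norm (g k)}" "card {k. t < norm (g k)} \<le> n"
      let ?U = "{k. s < norm (f k)} \<union> {k. t < norm (g k)}"
      have sub: "{k. s + t < norm (f k + g k)} \<subseteq> ?U"
      proof (rule subsetI, rule ccontr)
        fix k assume "k \<in> {k. s + t < norm (f k + g k)}" "k \<notin> ?U"
        then show False
          using norm_triangle_ineq[of "f k" "g k"] by simp
      qed
      have fin: "finite ?U"
        using s t by simp
      have "card ?U \<le> m + n"
        using card_Un_le[of "{k. s < norm (f k)}" "{k. t < norm (g k)}"] s(3) t(3) by linarith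
      then have "card {k. s + t < norm (f k + g k)} \<le> m + n"
        using card_mono[OF fin sub] by linarith
      then have "dr (\<lambda>k. f k + g k) (m + n) \<le> s + t"
        using s(1) t(1) finite_subset[OF sub fin] by (intro dr_le) auto
      then show "dr (\<lambda>k. f k + g k) (m + n) - s \<le> t" by simp
    qed
    then show "dr (\<lambda>k. f k + g k) (m + n) - dr g n \<le> s" by simp
  qed
  then show ?thesis by simp
qed

section \<open>Enumeration by decreasing modulus and the rearrangement inequality\<close>

lemma ex_maximal_norm:
  assumes "f \<in> c0" "finite A"
  shows "\<exists>k. k \<notin> A \<and> (\<forall>l. l \<notin> A \<longrightarrow> norm (f l) \<le> norm (f k))"
proof (cases "\<exists>k. k \<notin> A \<and> f k \<noteq> 0")
  case False
  obtain k where "k \<notin> A"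
    using ex_new_if_finite[OF infinite_UNIV_nat assms(2)] by blast
  with False show ?thesis
    by (intro exI[of _ k]) auto
next
  case True
  then obtain k where k: "k \<notin> A" "f k \<noteq> 0" by blast
  \<comment> \<open>Since \<open>f\<close> tends to 0, only finitely many entries are at least as
    large as \<open>f k\<close>; a maximum over those outside \<open>A\<close> is a maximum over
    everything outside \<open>A\<close>.\<close>
  let ?L = "{l. norm (f k) \<le> norm (f l)} - A"
  have fin: "finite ?L" "?L \<noteq> {}"
    using c0_finite_greater[OF assms(1), of "norm (f k)"] k by auto
  then have "Max ((\<lambda>i. norm (f i)) ` ?L) \<in> (\<lambda>i. norm (f i)) ` ?L"
    by (intro Max_in) auto
  then obtain l where l: "l \<in> ?L" "norm (f l) = Max ((\<lambda>i. norm (f i)) ` ?L)"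
    by (metis (no_types, lifting) imageE)
  then have l_max: "norm (f i) \<le> norm (f l)" if "i \<in> ?L" for i
    using fin that by simp
  show ?thesis
  proof (intro exI[of _ l] conjI allI impI)
    show "l \<notin> A" using l by simp
    fix i assume "i \<notin> A"
    show "norm (f i) \<le> norm (f l)"
    proof (cases "norm (f k) \<le> norm (f i)")
      case True
      then show ?thesis using l_max \<open>i \<notin> A\<close> by simp
    next
      case False
      then show ?thesis using l(1) by simp
    qed
  qed
qed

text \<open>Choosing greedily an index of maximal norm among the remaining ones exhausts the support
  of \<open>f\<close>, also when the support is finite.\<close>

lemma decreasing_enumeration:
  fixes f :: "nat \<Rightarrow> 'a::real_normed_vector"
  assumes "f \<in> c0"
  shows "\<exists>\<pi>. inj \<pi> \<and> (\<forall>n. norm (f (\<pi> n)) = dr f n) \<and> (\<forall>k. k \<notin> range \<pi> \<longrightarrow> f k = 0)"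
proof -
  define sel where "sel A = (SOME k. k \<notin> A \<and> (\<forall>l. l \<notin> A \<longrightarrow> norm (f l) \<le> norm (f k)))" for A
  have sel: "sel A \<notin> A" "\<And>l. l \<notin> A \<Longrightarrow> norm (f l) \<le> norm (f (sel A))" if "finite A" for A
    using someI_ex[OF ex_maximal_norm[OF assms that]] by (auto simp: sel_def)
  define used where "used = rec_nat {} (\<lambda>_ A. insert (sel A) A)"
  have used_simps: "used 0 = {}" "\<And>n. used (Suc n) = insert (sel (used n)) (used n)"
    by (auto simp: used_def)
  define \<pi> where "\<pi> n = sel (used n)" for n
  have used: "used n = \<pi> ` {..<n}" for n
    by (induction n) (auto simp: used_simps \<pi>_def lessThan_Suc)
  have new: "\<pi> n \<notin> \<pi> ` {..<n}" and max: "\<And>l. l \<notin> \<pi> ` {..<n} \<Longrightarrow> norm (f l) \<le> norm (f (\<pi> n))" for n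
    using sel[of "used n"] by (auto simp: used[symmetric] \<pi>_def[of n]) (auto simp: used)
  have inj: "inj \<pi>"
  proof (rule linorder_injI)
    fix m n :: nat assume "m < n"
    then show "\<pi> m \<noteq> \<pi> n" using new[of n] by (metis imageI lessThan_iff)
  qed
  have anti: "antimono (\<lambda>n. norm (f (\<pi> n)))"
  proof (rule antimonoI)
    fix m n :: nat assume "m \<le> n"
    then have "\<pi> n \<notin> \<pi> ` {..<m}"
      using inj by (auto simp: inj_eq)
    then show "norm (f (\<pi> n)) \<le> norm (f (\<pi> m))" by (rule max)
  qed
  \<comment> \<open>An index that is never chosen loses against every chosen one. Were its entry
    nonzero, infinitely many entries would have at least that modulus.\<close>
  have cover: "f k = 0" if k: "k \<notin> range \<pi>" for k
  proof (rule ccontr)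
    assume "f k \<noteq> 0"
    then have "finite {l. norm (f k) \<le> norm (f l)}"
      by (intro c0_finite_greater[OF assms]) simp
    moreover have "range \<pi> \<subseteq> {l. norm (f k) \<le> norm (f l)}"
      using max k by blast
    ultimately have "finite (range \<pi>)"
      by (rule finite_subset[rotated])
    then show False
      using inj by (simp add: finite_image_iff)
  qed
  have eq: "norm (f (\<pi> n)) = dr f n" for n
  proof (rule antisym)
    show "dr f n \<le> norm (f (\<pi> n))"
      using anti cover by (intro dr_le_of_enumeration[of "\<lambda>n. norm (f (\<pi> n))" f \<pi>]) auto
    show "norm (f (\<pi> n)) \<le> dr f n"
    proof (rule dr_greatest[OF assms], rule ccontr)
      fix t :: real
      assume t: "finite {k. t < norm (f k)}" "card {k. t < norm (f k)} \<le> n"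
        and "\<not> norm (f (\<pi> n)) \<le> t"
      moreover have "norm (f (\<pi> n)) \<le> norm (f (\<pi> m))" if "m \<le> n" for m
        using antimonoD[OF anti that] by simp
      ultimately have "\<pi> ` {..n} \<subseteq> {k. t < norm (f k)}"
        by force
      then have "card (\<pi> ` {..n}) \<le> n"
        using t by (meson card_mono le_trans)
      then show False
        using inj by (simp add: card_image inj_on_subset[OF inj])
    qed
  qed
  show ?thesis
    using inj eq cover by blast
qed

text \<open>A Hardy-Littlewood inequality with constant 2, which is enough for equivalent norms. An
  index at position i for \<open>f\<close> and j for \<open>g\<close> contributes
  \<open>dr f i * dr g j\<close>, which is at most the product of both rearrangements at min(i, j),
  hence at most the sum of their products at i and at j. Each of the two position maps is injective,
  which accounts for the factor 2.\<close>

lemma sum_norm_le_rearrangement: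
  fixes f g :: "nat \<Rightarrow> 'a::real_normed_field"
  assumes "f \<in> c0" "g \<in> c0" "finite A"
  shows "\<exists>M. (\<Sum>k\<in>A. norm (f k * g k)) \<le> 2 * (\<Sum>n<M. dr f n * dr g n)"
proof -
  obtain \<pi> where pi: "inj \<pi>" "\<forall>n. norm (f (\<pi> n)) = dr f n" "\<forall>k. k \<notin> range \<pi> \<longrightarrow> f k = 0"
    using decreasing_enumeration[OF assms(1)] by auto
  obtain \<rho> where rho: "inj \<rho>" "\<forall>n. norm (g (\<rho> n)) = dr g n" "\<forall>k. k \<notin> range \<rho> \<longrightarrow> g k = 0"
    using decreasing_enumeration[OF assms(2)] by auto
  \<comment> \<open>Outside \<open>B\<close> one of the two enumerations misses the index, so the
    product vanishes there.\<close>
  define B where "B = A \<inter> range \<pi> \<inter> range \<rho>"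
  define i where "i = inv \<pi>"
  define j where "j = inv \<rho>"
  have i: "\<pi> (i k) = k" and j: "\<rho> (j k) = k" if "k \<in> B" for k
    using that by (auto simp: B_def i_def j_def f_inv_into_f)
  have injs: "inj_on i B" "inj_on j B"
    using i j by (metis inj_onI)+
  have "finite (i ` B \<union> j ` B)"
    using assms(3) by (simp add: B_def)
  then obtain M where M: "i ` B \<union> j ` B \<subseteq> {..<M}"
    using finite_nat_iff_bounded by blast
  let ?p = "\<lambda>n. dr f n * dr g n"
  have pos: "0 \<le> ?p n" for n
    using dr_nonneg[OF assms(1)] dr_nonneg[OF assms(2)] by simp
  have part: "(\<Sum>k\<in>B. ?p (h k)) \<le> (\<Sum>n<M. ?p n)" if "inj_on h B" "h ` B \<subseteq> {..<M}" for h
  proof -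
    have "(\<Sum>k\<in>B. ?p (h k)) = sum ?p (h ` B)"
      using sum.reindex[OF that(1), of ?p] by simp
    also have "\<dots> \<le> (\<Sum>n<M. ?p n)"
      using that(2) pos by (intro sum_mono2) auto
    finally show ?thesis .
  qed
  have "(\<Sum>k\<in>A. norm (f k * g k)) = (\<Sum>k\<in>B. norm (f k * g k))"
    using assms(3) pi(3) rho(3) by (intro sum.mono_neutral_right) (auto simp: B_def)
  also have "\<dots> \<le> (\<Sum>k\<in>B. ?p (i k) + ?p (j k))"
  proof (rule sum_mono)
    fix k assume k: "k \<in> B"
    have eq: "norm (f k * g k) = dr f (i k) * dr g (j k)"
      using pi(2)[THEN spec, of "i k"] rho(2)[THEN spec, of "j k"] i[OF k] j[OF k] by (simp add: norm_mult)
    show "norm (f k * g k) \<le> ?p (i k) + ?p (j k)"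
    proof (cases "i k \<le> j k")
      case True
      then have "dr f (i k) * dr g (j k) \<le> ?p (i k)"
        using dr_antimono[OF assms(2)] dr_nonneg[OF assms(1)] by (intro mult_left_mono) auto
      then show ?thesis using eq pos[of "j k"] by linarith
    next
      case False
      then have "dr f (i k) * dr g (j k) \<le> ?p (j k)"
        using dr_antimono[OF assms(1)] dr_nonneg[OF assms(2)] by (intro mult_right_mono) auto
      then show ?thesis using eq pos[of "i k"] by linarith
    qed
  qed
  also have "\<dots> = (\<Sum>k\<in>B. ?p (i k)) + (\<Sum>k\<in>B. ?p (j k))"
    by (rule sum.distrib)
  also have "\<dots> \<le> 2 * (\<Sum>n<M. ?p n)"
    using part[OF injs(1)] part[OF injs(2)] M by auto
  finally show ?thesis by blast
qed

section \<open>Dyadic form of the Lorentz norm\<close>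

lemma primitive_mono: "weight w \<Longrightarrow> m \<le> n \<Longrightarrow> primitive w m \<le> primitive w n"
  unfolding primitive_def by (intro sum_mono2) (auto simp: weight_def)

lemma primitive_pos:
  assumes "weight w" "1 \<le> n"
  shows "0 < primitive w n"
proof -
  have "0 < primitive w 1"
    using assms(1) by (simp add: primitive_def weight_def)
  also have "\<dots> \<le> primitive w n"
    using assms by (rule primitive_mono)
  finally show ?thesis .
qed

lemma sum_weight_block: "m \<le> n \<Longrightarrow> sum w {m..<n} = primitive w n - primitive w m"
  by (simp add: primitive_def sum_diff_nat_ivl[of 0 m n w, symmetric] flip: atLeast0LessThan)

lemma lorentz_term_nonneg: "weight w \<Longrightarrow> 0 \<le> lorentz_term q w f n"
  using primitive_pos[of w "Suc n"] by (auto simp: lorentz_term_def weight_def)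

text \<open>For 1 < q the exponent of the primitive sequence is positive, so in this form every
  factor except \<open>w n\<close> is monotone in \<open>n\<close>; this is what the block estimates
  exploit.\<close>

lemma lorentz_term_eq:
  assumes "weight w" "f \<in> c0"
  shows "lorentz_term q w f n = dr f n powr q * primitive w (Suc n) powr (q - 1) * w n"
  using primitive_pos[OF assms(1), of "Suc n"] dr_nonneg[OF assms(2), of n]
  by (simp add: lorentz_term_def powr_mult powr_diff)

text \<open>Young's inequality is applied to the entries normalised by the two norms; the
  normalisation fails only if one of the norms is 0, and then all products vanish.\<close>

lemma Holder_sum:
  fixes x y :: "'i \<Rightarrow> real"
  assumes pq: "1 < p" "1 < q" "1 / p + 1 / q = 1"
    and nonneg: "\<And>i. i \<in> A \<Longrightarrow> 0 \<le> x i" "\<And>i. i \<in> A \<Longrightarrow> 0 \<le> y i" and "finite A"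
  shows "(\<Sum>i\<in>A. x i * y i) \<le> (\<Sum>i\<in>A. x i powr p) powr (1 / p) * (\<Sum>i\<in>A. y i powr q) powr (1 / q)"
proof -
  define X where "X = (\<Sum>i\<in>A. x i powr p)"
  define Y where "Y = (\<Sum>i\<in>A. y i powr q)"
  have XY: "0 \<le> X" "0 \<le> Y"
    by (auto simp: X_def Y_def intro: sum_nonneg)
  show ?thesis
  proof (cases "X = 0 \<or> Y = 0")
    case True
    then have "\<And>i. i \<in> A \<Longrightarrow> x i * y i = 0"
      using \<open>finite A\<close> by (auto simp: X_def Y_def sum_nonneg_eq_0_iff)
    then have "(\<Sum>i\<in>A. x i * y i) = 0"
      by (rule sum.neutral[OF ballI])
    then show ?thesis
      by (simp only: X_def[symmetric] Y_def[symmetric]) simp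
  next
    case False
    then have pos: "0 < X" "0 < Y" using XY by auto
    let ?a = "X powr (1 / p)" and ?b = "Y powr (1 / q)"
    have ab: "0 < ?a" "0 < ?b" using pos by auto
    have "(\<Sum>i\<in>A. (x i / ?a) * (y i / ?b)) \<le> (\<Sum>i\<in>A. x i powr p / X / p + y i powr q / Y / q)"
    proof (rule sum_mono)
      fix i assume i: "i \<in> A"
      have "(x i / ?a) * (y i / ?b) \<le> (x i / ?a) powr p / p + (y i / ?b) powr q / q"
        using nonneg[OF i] ab by (intro Youngs_inequality[OF pq]) auto
      moreover have "(x i / ?a) powr p = x i powr p / X"
        using nonneg[OF i] pos pq by (simp add: powr_divide powr_powr)
      moreover have "(y i / ?b) powr q = y i powr q / Y"
        using nonneg[OF i] pos pq by (simp add: powr_divide powr_powr)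
      ultimately show "(x i / ?a) * (y i / ?b) \<le> x i powr p / X / p + y i powr q / Y / q"
        by simp
    qed
    also have "\<dots> = X / X / p + Y / Y / q"
      by (simp only: sum.distrib sum_divide_distrib[symmetric] X_def[symmetric] Y_def[symmetric])
    also have "\<dots> = 1"
      using pos pq by simp
    finally have "(\<Sum>i\<in>A. x i * y i) / (?a * ?b) \<le> 1"
      by (simp add: sum_divide_distrib)
    then show ?thesis
      using ab by (simp add: X_def Y_def divide_le_eq)
  qed
qed

text \<open>Rearrangements count from 0 and primitive sequences from 1, so the entry
  \<open>B ^ j - 1\<close> of \<open>dr f\<close> is the one that belongs to
  \<open>primitive w (B ^ j)\<close>.\<close>

definition dyadic_term ::
  "real \<Rightarrow> (nat \<Rightarrow> real) \<Rightarrow> nat \<Rightarrow> (nat \<Rightarrow> 'a::real_normed_vector) \<Rightarrow> nat \<Rightarrow> real" where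
  "dyadic_term q w B f j = (dr f (B ^ j - 1) * primitive w (B ^ j)) powr q"

lemma dyadic_term_nonneg [simp]: "0 \<le> dyadic_term q w B f j"
  by (simp add: dyadic_term_def)

locale regular_weight =
  fixes w :: "nat \<Rightarrow> real" and B :: nat and K :: real
  assumes weight: "weight w" and base: "2 \<le> B"
    and lower: "\<And>j. 2 * primitive w (B ^ j) \<le> primitive w (B ^ Suc j)"
    and upper: "\<And>j. primitive w (B ^ Suc j) \<le> K * primitive w (B ^ j)"
begin

abbreviation S where "S j \<equiv> primitive w (B ^ j)"

lemma S_pos: "0 < S j"
  using base by (intro primitive_pos weight) simp

lemma K_ge: "2 \<le> K"
proof -
  have "2 * S 0 \<le> K * S 0"
    using lower[of 0] upper[of 0] by linarith
  then show ?thesis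
    using S_pos[of 0] by simp
qed

text \<open>On the block, \<open>dr f\<close> is at most its value just before the block, and both
  the primitive sequence and the mass of the block are at most \<open>K * S j\<close>.\<close>

lemma block_le:
  assumes "f \<in> c0" "1 < q"
  shows "sum (lorentz_term q w f) {B ^ j..<B ^ Suc j} \<le> K powr q * dyadic_term q w B f j"
proof -
  let ?a = "dr f (B ^ j - 1)"
  have a: "0 \<le> ?a" by (rule dr_nonneg[OF assms(1)])
  have "sum (lorentz_term q w f) {B ^ j..<B ^ Suc j}
      \<le> (\<Sum>n\<in>{B ^ j..<B ^ Suc j}. ?a powr q * (K * S j) powr (q - 1) * w n)"
  proof (rule sum_mono)
    fix n assume n: "n \<in> {B ^ j..<B ^ Suc j}"
    have "dr f n powr q \<le> ?a powr q"
      using n assms dr_nonneg[OF assms(1)] by (intro powr_mono2 dr_antimono) auto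
    moreover have "primitive w (Suc n) \<le> K * S j"
      using primitive_mono[OF weight, of "Suc n" "B ^ Suc j"] n upper[of j] by auto
    then have "primitive w (Suc n) powr (q - 1) \<le> (K * S j) powr (q - 1)"
      using primitive_pos[OF weight, of "Suc n"] assms by (intro powr_mono2) auto
    ultimately show "lorentz_term q w f n \<le> ?a powr q * (K * S j) powr (q - 1) * w n"
      unfolding lorentz_term_eq[OF weight assms(1)] using weight
      by (intro mult_right_mono mult_mono) (auto simp: weight_def)
  qed
  also have "\<dots> = ?a powr q * (K * S j) powr (q - 1) * (S (Suc j) - S j)"
    using base by (simp only: sum_distrib_left[symmetric]) (simp add: sum_weight_block)
  also have "\<dots> \<le> ?a powr q * (K * S j) powr (q - 1) * (K * S j)"
    using upper[of j] S_pos[of j] by (intro mult_left_mono) auto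
  also have "\<dots> = ?a powr q * (K * S j) powr q"
    using K_ge S_pos[of j] by (simp add: powr_diff)
  also have "\<dots> = K powr q * dyadic_term q w B f j"
    using K_ge S_pos[of j] a by (simp add: dyadic_term_def powr_mult)
  finally show ?thesis .
qed

text \<open>The smallest value of \<open>dr f\<close> on the block is the last one, which belongs to
  the dyadic term of index \<open>Suc j\<close>; hence the shift. The mass of the block is at least
  \<open>S j\<close> by \<open>lower\<close>, and replacing \<open>S (Suc j)\<close> by
  \<open>S j\<close> costs the factor \<open>K powr q\<close>.\<close>

lemma block_ge:
  assumes "f \<in> c0" "1 < q"
  shows "dyadic_term q w B f (Suc j) \<le> K powr q * sum (lorentz_term q w f) {B ^ j..<B ^ Suc j}"
proof -
  let ?a = "dr f (B ^ Suc j - 1)"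
  have a: "0 \<le> ?a" by (rule dr_nonneg[OF assms(1)])
  have "dyadic_term q w B f (Suc j) \<le> (?a * (K * S j)) powr q"
    unfolding dyadic_term_def using upper[of j] a assms S_pos[of "Suc j"]
    by (intro powr_mono2 mult_left_mono mult_nonneg_nonneg) auto
  also have "\<dots> = K powr q * (?a powr q * S j powr (q - 1) * S j)"
    using K_ge S_pos[of j] a by (simp add: powr_mult powr_diff)
  also have "\<dots> \<le> K powr q * (?a powr q * S j powr (q - 1) * (S (Suc j) - S j))"
    using lower[of j] by (intro mult_left_mono) auto
  also have "?a powr q * S j powr (q - 1) * (S (Suc j) - S j)
      = (\<Sum>n\<in>{B ^ j..<B ^ Suc j}. ?a powr q * S j powr (q - 1) * w n)"
    using base by (simp only: sum_distrib_left[symmetric]) (simp add: sum_weight_block)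
  also have "\<dots> \<le> sum (lorentz_term q w f) {B ^ j..<B ^ Suc j}"
  proof (rule sum_mono)
    fix n assume n: "n \<in> {B ^ j..<B ^ Suc j}"
    have "?a powr q \<le> dr f n powr q"
      using n assms a by (intro powr_mono2 dr_antimono) auto
    moreover have "S j \<le> primitive w (Suc n)"
      using primitive_mono[OF weight, of "B ^ j" "Suc n"] n by auto
    then have "S j powr (q - 1) \<le> primitive w (Suc n) powr (q - 1)"
      using S_pos[of j] assms by (intro powr_mono2) auto
    ultimately show "?a powr q * S j powr (q - 1) * w n \<le> lorentz_term q w f n"
      unfolding lorentz_term_eq[OF weight assms(1)] using weight
      by (intro mult_right_mono mult_mono) (auto simp: weight_def)
  qed
  finally show ?thesis by (simp add: mult_left_mono)
qed

lemma sum_blocks: "sum h {..<B ^ Suc j} = sum h {..<B ^ j} + sum h {B ^ j..<B ^ Suc j}"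
  for h :: "nat \<Rightarrow> real"
proof -
  have "B ^ j \<le> B ^ Suc j" using base by simp
  then show ?thesis
    unfolding lessThan_atLeast0 by (simp only: sum.atLeastLessThan_concat[of 0])
qed

text \<open>The blocks start at B^0 = 1 and miss the entry 0, which has to be treated on its own;
  there the quotient of weight and primitive sequence is 1.\<close>

lemma lorentz_term_0: "lorentz_term q w f 0 = dyadic_term q w B f 0"
  using weight by (simp add: lorentz_term_def dyadic_term_def primitive_def weight_def)

lemma partial_sum_le:
  assumes "f \<in> c0" "1 < q"
  shows "sum (lorentz_term q w f) {..<B ^ J}
    \<le> dyadic_term q w B f 0 + K powr q * sum (dyadic_term q w B f) {..<J}"
proof (induction J)
  case 0
  show ?case using lorentz_term_0[of q f] by simp
next
  case (Suc J)
  then show ?case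
    using block_le[OF assms, of J] unfolding sum_blocks by (simp add: distrib_left)
qed

lemma partial_sum_ge:
  assumes "f \<in> c0" "1 < q"
  shows "sum (dyadic_term q w B f) {..J} \<le> K powr q * sum (lorentz_term q w f) {..<B ^ J}"
proof (induction J)
  case 0
  have "1 * dyadic_term q w B f 0 \<le> K powr q * dyadic_term q w B f 0"
    using K_ge assms(2) by (intro mult_right_mono ge_one_powr_ge_zero) auto
  then show ?case using lorentz_term_0[of q f] by simp
next
  case (Suc J)
  then show ?case
    using block_ge[OF assms, of J] unfolding sum_blocks by (simp add: distrib_left)
qed

lemma lorentz_of_dyadic:
  assumes "f \<in> c0" "1 < q" "summable (dyadic_term q w B f)"
  shows "f \<in> lorentz_space q w"
    and "(\<Sum>n. lorentz_term q w f n) \<le> (1 + K powr q) * (\<Sum>j. dyadic_term q w B f j)"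
proof -
  have bound: "sum (lorentz_term q w f) {..<N} \<le> (1 + K powr q) * (\<Sum>j. dyadic_term q w B f j)" for N
  proof -
    have "N < B ^ N"
      using base by (intro power_gt_expt) auto
    then have "sum (lorentz_term q w f) {..<N} \<le> sum (lorentz_term q w f) {..<B ^ N}"
      using lorentz_term_nonneg[OF weight] by (intro sum_mono2) auto
    also have "\<dots> \<le> dyadic_term q w B f 0 + K powr q * sum (dyadic_term q w B f) {..<N}"
      by (rule partial_sum_le[OF assms(1,2)])
    also have "\<dots> \<le> (\<Sum>j. dyadic_term q w B f j) + K powr q * (\<Sum>j. dyadic_term q w B f j)"
      using sum_le_suminf[OF assms(3), of "{0}"] sum_le_suminf[OF assms(3), of "{..<N}"]
      by (intro add_mono mult_left_mono) auto
    finally show ?thesis by (simp add: distrib_right)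
  qed
  have sum: "summable (lorentz_term q w f)"
    using lorentz_term_nonneg[OF weight] bound by (intro summableI_nonneg_bounded) auto
  then show "f \<in> lorentz_space q w"
    using assms(1) by (simp add: lorentz_space_def)
  show "(\<Sum>n. lorentz_term q w f n) \<le> (1 + K powr q) * (\<Sum>j. dyadic_term q w B f j)"
    using bound by (intro suminf_le_const sum) auto
qed

lemma dyadic_of_lorentz:
  assumes "1 < q" "f \<in> lorentz_space q w"
  shows "summable (dyadic_term q w B f)"
    and "(\<Sum>j<J. dyadic_term q w B f j) powr (1 / q) \<le> K * lorentz_norm q w f"
proof -
  have f: "f \<in> c0" "summable (lorentz_term q w f)"
    using assms(2) by (auto simp: lorentz_space_def)
  have bound: "(\<Sum>j<J. dyadic_term q w B f j) \<le> K powr q * (\<Sum>n. lorentz_term q w f n)" for J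
  proof -
    have "(\<Sum>j<J. dyadic_term q w B f j) \<le> (\<Sum>j\<le>J. dyadic_term q w B f j)"
      by (intro sum_mono2) auto
    also have "\<dots> \<le> K powr q * sum (lorentz_term q w f) {..<B ^ J}"
      by (rule partial_sum_ge[OF f(1) assms(1)])
    also have "\<dots> \<le> K powr q * (\<Sum>n. lorentz_term q w f n)"
      using lorentz_term_nonneg[OF weight] by (intro mult_left_mono sum_le_suminf f) auto
    finally show ?thesis .
  qed
  show "summable (dyadic_term q w B f)"
    using bound by (intro summableI_nonneg_bounded) auto
  have "(\<Sum>j<J. dyadic_term q w B f j) powr (1 / q) \<le> (K powr q * (\<Sum>n. lorentz_term q w f n)) powr (1 / q)"
    using bound assms(1) by (intro powr_mono2 sum_nonneg) auto
  also have "\<dots> = K * lorentz_norm q w f"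
    using K_ge assms(1) suminf_nonneg[OF f(2) lorentz_term_nonneg[OF weight]]
    by (simp add: powr_mult powr_powr lorentz_norm_def)
  finally show "(\<Sum>j<J. dyadic_term q w B f j) powr (1 / q) \<le> K * lorentz_norm q w f" .
qed

text \<open>Adding two sequences doubles the index in the rearrangement. As \<open>B\<close> is at
  least 2, the doubled index 2 (B^j - 1) is still at most B^(j+1) - 1, so the dyadic term j + 1 of
  the sum is controlled by the dyadic terms j of the summands, at the price of a factor
  \<open>K\<close>.\<close>

lemma lorentz_space_add:
  assumes "1 < q" "f \<in> lorentz_space q w" "g \<in> lorentz_space q w"
  shows "(\<lambda>n. f n + g n) \<in> lorentz_space q w"
proof -
  have c0: "f \<in> c0" "g \<in> c0"
    using assms by (auto simp: lorentz_space_def)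
  let ?h = "\<lambda>n. f n + g n"
  let ?a = "\<lambda>j. dyadic_term q w B f j" and ?b = "\<lambda>j. dyadic_term q w B g j"
  have h: "?h \<in> c0" by (rule c0_add[OF c0])
  have "dyadic_term q w B ?h (Suc j) \<le> (2 * K) powr q * (?a j + ?b j)" for j
  proof -
    let ?x = "dr f (B ^ j - 1)" and ?y = "dr g (B ^ j - 1)"
    have xy: "0 \<le> ?x" "0 \<le> ?y" using dr_nonneg c0 by auto
    have "2 * B ^ j \<le> B ^ Suc j" using base by simp
    then have "(B ^ j - 1) + (B ^ j - 1) \<le> B ^ Suc j - 1" by linarith
    then have "dr ?h (B ^ Suc j - 1) \<le> ?x + ?y"
      by (rule order_trans[OF dr_antimono[OF h] dr_add_le[OF c0]])
    then have "dyadic_term q w B ?h (Suc j) \<le> ((?x + ?y) * (K * S j)) powr q"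
      unfolding dyadic_term_def using upper[of j] dr_nonneg[OF h] assms(1) S_pos[of "Suc j"] xy
      by (intro powr_mono2 mult_mono mult_nonneg_nonneg) auto
    also have "\<dots> \<le> ((2 * max ?x ?y) * (K * S j)) powr q"
      using xy K_ge S_pos[of j] assms(1)
      by (intro powr_mono2 mult_right_mono mult_nonneg_nonneg) auto
    also have "\<dots> = ((2 * K) * (max ?x ?y * S j)) powr q"
      by (simp add: mult_ac)
    also have "\<dots> = (2 * K) powr q * (max ?x ?y * S j) powr q"
      using xy K_ge S_pos[of j] by (subst powr_mult) auto
    also have "(max ?x ?y * S j) powr q \<le> ?a j + ?b j"
      by (auto simp: max_def dyadic_term_def)
    finally show ?thesis by (simp add: mult_left_mono)
  qed
  moreover have "summable (\<lambda>j. (2 * K) powr q * (?a j + ?b j))"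
    by (rule summable_mult[OF summable_add[OF dyadic_of_lorentz(1)[OF assms(1,2)] dyadic_of_lorentz(1)[OF assms(1,3)]]])
  ultimately have "summable (\<lambda>j. dyadic_term q w B ?h (Suc j))"
    by - (rule summable_comparison_test'[where N = 0], assumption, simp)
  then have "summable (dyadic_term q w B ?h)"
    by (simp add: summable_Suc_iff)
  then show ?thesis
    by (rule lorentz_of_dyadic(1)[OF h assms(1)])
qed

end

section \<open>Homogeneity, monotonicity and finite supports\<close>

lemma lorentz_scale:
  fixes f :: "nat \<Rightarrow> 'a::real_normed_field"
  assumes "0 < q" "weight w" "f \<in> lorentz_space q w"
  shows "(\<lambda>n. c * f n) \<in> lorentz_space q w"
    and "lorentz_norm q w (\<lambda>n. c * f n) = norm c * lorentz_norm q w f"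
proof -
  have f: "f \<in> c0" "summable (lorentz_term q w f)"
    using assms(3) by (auto simp: lorentz_space_def)
  have eq: "lorentz_term q w (\<lambda>n. c * f n) = (\<lambda>n. norm c powr q * lorentz_term q w f n)"
    using primitive_pos[OF assms(2)] dr_nonneg[OF f(1)]
    by (intro ext) (simp add: lorentz_term_def dr_scale[OF f(1)] powr_mult mult_ac)
  show "(\<lambda>n. c * f n) \<in> lorentz_space q w"
    using f c0_scale[OF f(1)] by (simp add: lorentz_space_def eq summable_mult)
  show "lorentz_norm q w (\<lambda>n. c * f n) = norm c * lorentz_norm q w f"
    using f assms(1) suminf_nonneg[OF f(2) lorentz_term_nonneg[OF assms(2)]]
    by (simp add: lorentz_norm_def eq suminf_mult powr_mult powr_powr)
qed

lemma lorentz_norm_nonneg: "0 \<le> lorentz_norm q w f"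
  by (simp add: lorentz_norm_def)

lemma lorentz_mono:
  assumes "0 < q" "weight w" "g \<in> lorentz_space q w" "f \<in> c0" "\<And>k. norm (f k) \<le> norm (g k)"
  shows "f \<in> lorentz_space q w" "lorentz_term q w f n \<le> lorentz_term q w g n"
proof -
  have g: "g \<in> c0" "summable (lorentz_term q w g)"
    using assms(3) by (auto simp: lorentz_space_def)
  have le: "lorentz_term q w f n \<le> lorentz_term q w g n" for n
  proof -
    have "dr f n \<le> dr g n"
      by (intro dr_mono g assms(5))
    then have "dr f n powr q \<le> dr g n powr q"
      using dr_nonneg[OF assms(4), of n] assms(1) by (intro powr_mono2) simp_all
    moreover have "0 \<le> w n" using assms(2) by (simp add: weight_def)
    ultimately show ?thesis
      unfolding lorentz_term_eq[OF assms(2,4)] lorentz_term_eq[OF assms(2) g(1)]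
      by (intro mult_right_mono) simp_all
  qed
  show "lorentz_term q w f n \<le> lorentz_term q w g n" by (rule le)
  have "summable (lorentz_term q w f)"
    using lorentz_term_nonneg[OF assms(2), of q f] le
    by (intro summable_comparison_test'[OF g(2), of 0]) simp
  then show "f \<in> lorentz_space q w"
    using assms(4) by (simp add: lorentz_space_def)
qed

lemma lorentz_finite_support:
  assumes "finite {k. f k \<noteq> 0}"
  shows "f \<in> lorentz_space q w"
proof -
  have f: "f \<in> c0" using assms by (rule c0_finite_support)
  have "lorentz_term q w f n = 0" if "n \<notin> {..<card {k. f k \<noteq> 0}}" for n
  proof -
    have "dr f n \<le> 0"
      using assms that by (intro dr_le) auto
    then have "dr f n = 0"
      using dr_nonneg[OF f, of n] by simp
    then show ?thesis by (simp add: lorentz_term_def)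
  qed
  then have "summable (lorentz_term q w f)"
    by (intro summable_finite[of "{..<card {k. f k \<noteq> 0}}"]) auto
  then show ?thesis using f by (simp add: lorentz_space_def)
qed

section \<open>Functionals and their coefficients\<close>

definition unit_seq :: "nat \<Rightarrow> nat \<Rightarrow> 'a::real_normed_field" where
  "unit_seq k = (\<lambda>i. if i = k then 1 else 0)"

lemma dual_space_finite_support:
  fixes f :: "nat \<Rightarrow> 'a::real_normed_field"
  assumes \<phi>: "\<phi> \<in> dual_space (lorentz_space q w) N" and "finite A"
  shows "\<phi> (\<lambda>k. if k \<in> A then f k else 0) = (\<Sum>k\<in>A. f k * \<phi> (unit_seq k))"
  using \<open>finite A\<close>
proof induction
  case empty
  have X: "(\<lambda>k. 0) \<in> lorentz_space q w"
    by (rule lorentz_finite_support) simp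
  have "\<forall>c. \<forall>f\<in>lorentz_space q w. \<phi> (\<lambda>n. c * f n) = c * \<phi> f"
    using \<phi> by (simp add: dual_space_def)
  from this[rule_format, OF X, of 0] show ?case by simp
next
  case (insert a A)
  have X: "(\<lambda>k. if k \<in> A then f k else 0) \<in> lorentz_space q w"
    using insert(1) by (intro lorentz_finite_support) (auto elim: rev_finite_subset)
  have U: "(unit_seq a :: nat \<Rightarrow> 'a) \<in> lorentz_space q w" "(\<lambda>k. f a * unit_seq a k) \<in> lorentz_space q w"
    by (auto intro!: lorentz_finite_support simp: unit_seq_def)
  have eq: "(\<lambda>k. if k \<in> insert a A then f k else 0)
      = (\<lambda>k. f a * unit_seq a k + (if k \<in> A then f k else 0))"
    using insert(2) by (auto simp: unit_seq_def)
  have "\<phi> (\<lambda>k. if k \<in> insert a A then f k else 0)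
      = \<phi> (\<lambda>k. f a * unit_seq a k) + \<phi> (\<lambda>k. if k \<in> A then f k else 0)"
    unfolding eq using \<phi> X U(2) by (simp add: dual_space_def)
  also have "\<phi> (\<lambda>k. f a * unit_seq a k) = f a * \<phi> (unit_seq a)"
    using \<phi> U(1) by (simp add: dual_space_def)
  finally show ?case
    using insert by simp
qed

text \<open>Dominated convergence for series: each Lorentz term of the tails tends to 0, because the
  supremum of the tail does, and it is dominated by the corresponding term of
  \<open>f\<close>.\<close>

lemma lorentz_tail_tendsto_0:
  fixes f :: "nat \<Rightarrow> 'a::real_normed_field"
  assumes "1 < q" "weight w" "f \<in> lorentz_space q w"
  shows "(\<lambda>N. lorentz_norm q w (\<lambda>k. if N \<le> k then f k else 0)) \<longlonglongrightarrow> 0"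
proof -
  define t where "t N = (\<lambda>k. if N \<le> k then f k else 0)" for N
  have f: "f \<in> c0" "summable (lorentz_term q w f)"
    using assms(3) by (auto simp: lorentz_space_def)
  have t_le: "norm (t N k) \<le> norm (f k)" for N k by (simp add: t_def)
  have t: "t N \<in> c0" for N
    using f(1) unfolding c0_def mem_Collect_eq
    by (rule Lim_null_comparison[rotated, OF tendsto_norm_zero]) (simp add: t_le)
  have dr0: "(\<lambda>N. dr (t N) n) \<longlonglongrightarrow> 0" for n
  proof (rule LIMSEQ_I)
    fix e :: real assume e: "0 < e"
    have "\<forall>r>0. eventually (\<lambda>k. norm (f k) < r) sequentially"
      using f(1) by (simp add: c0_def tendsto_iff)
    from this[rule_format, of "e / 2"] e have "eventually (\<lambda>k. norm (f k) < e / 2) sequentially"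
      by (simp del: less_divide_eq_numeral1)
    then obtain M where M: "\<And>k. M \<le> k \<Longrightarrow> norm (f k) < e / 2"
      by (auto simp: eventually_sequentially)
    have "norm (dr (t N) n - 0) < e" if N: "M \<le> N" for N
    proof -
      have "norm (t N k) \<le> e / 2" for k
        using M[of k] N e by (cases "N \<le> k") (simp_all add: t_def)
      then have "dr (t N) n \<le> e / 2"
        using e by (intro dr_le_of_norm_le) simp_all
      then show ?thesis
        using dr_nonneg[OF t[of N], of n] e by simp
    qed
    then show "\<exists>no. \<forall>N\<ge>no. norm (dr (t N) n - 0) < e" by blast
  qed
  have term0: "(\<lambda>N. lorentz_term q w (t N) n) \<longlonglongrightarrow> 0" for n
  proof -
    have "(\<lambda>N. (dr (t N) n * primitive w (Suc n)) powr q * (w n / primitive w (Suc n)))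
        \<longlonglongrightarrow> (0 * primitive w (Suc n)) powr q * (w n / primitive w (Suc n))"
      using assms(1) by (intro tendsto_mult tendsto_const tendsto_powr2 dr0)
        (auto intro!: always_eventually mult_nonneg_nonneg dr_nonneg t less_imp_le[OF primitive_pos] assms)
    then show ?thesis by (simp add: lorentz_term_def)
  qed
  have "eventually (\<lambda>(n, N). norm (lorentz_term q w (t N) n) \<le> lorentz_term q w f n) (at_top \<times>\<^sub>F sequentially)"
  proof (intro always_eventually allI, clarify)
    fix n N
    have "lorentz_term q w (t N) n \<le> lorentz_term q w f n"
      using assms(1) by (intro lorentz_mono(2)[OF _ assms(2,3) t t_le]) simp
    then show "norm (lorentz_term q w (t N) n) \<le> lorentz_term q w f n"
      using lorentz_term_nonneg[OF assms(2), of q "t N" n] by simp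
  qed
  from tannerys_theorem[OF term0 this f(2)]
  have "(\<lambda>N. \<Sum>n. lorentz_term q w (t N) n) \<longlonglongrightarrow> (\<Sum>n. 0)"
    by simp
  then have lim: "(\<lambda>N. \<Sum>n. lorentz_term q w (t N) n) \<longlonglongrightarrow> 0"
    by simp
  have nonneg: "0 \<le> (\<Sum>n. lorentz_term q w (t N) n)" for N
    using lorentz_mono(1)[OF _ assms(2,3) t t_le, of N] assms(1)
    by (intro suminf_nonneg lorentz_term_nonneg[OF assms(2)]) (simp add: lorentz_space_def)
  have "(\<lambda>N. (\<Sum>n. lorentz_term q w (t N) n) powr (1 / q)) \<longlonglongrightarrow> 0 powr (1 / q)"
    using lim assms(1) nonneg by (intro tendsto_powr2 tendsto_const) (auto intro!: always_eventually)
  then show ?thesis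
    by (simp add: lorentz_norm_def t_def)
qed

section \<open>Duality\<close>

locale dual_regular_weights =
  X: regular_weight w B K + Y: regular_weight w' B K'
  for w w' :: "nat \<Rightarrow> real" and B :: nat and K K' :: real +
  fixes q q' A :: real
  assumes q: "1 < q" and q': "q' = q / (q - 1)" and A: "0 < A"
    and power_le: "\<And>j. real (B ^ j) \<le> A * (X.S j * Y.S j)"
    and le_power: "\<And>j. X.S j * Y.S j \<le> A * real (B ^ j)"
begin

section \<open>Conjugate exponents and boundedness of the pairing\<close>

lemma q'_gt_1: "1 < q'"
  using q by (simp add: q' field_simps)

lemma conjugate: "1 / q + 1 / q' = 1"
  using q by (simp add: q' field_simps)

text \<open>In the test vector, \<open>Z j * X.S j\<close> equals \<open>v j powr (q' - 1)\<close>;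
  by this identity its q-th power is \<open>v j powr q'\<close>.\<close>

lemma dyadic_exponent: "(q' - 1) * q = q'"
  using q by (simp add: q' field_simps)

text \<open>The 2 comes from the rearrangement inequality, \<open>1 + real B\<close> from the entry
  0 and the block lengths, \<open>A\<close> from \<open>power_le\<close>, and \<open>K * K'\<close>
  from passing from dyadic to Lorentz norms.\<close>

definition pairing_const :: real where
  "pairing_const = 2 * ((1 + real B) * A * (K * K'))"

lemma pairing_const_pos: "0 < pairing_const"
  using A X.K_ge Y.K_ge by (auto simp: pairing_const_def intro!: mult_pos_pos)

lemma rearranged_sum_le:
  assumes "f \<in> lorentz_space q w" "g \<in> lorentz_space q' w'"
  shows "(\<Sum>n<M. dr f n * dr g n) \<le> (1 + real B) * A * (K * K') * (lorentz_norm q w f * lorentz_norm q' w' g)"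
proof -
  have c0: "f \<in> c0" "g \<in> c0"
    using assms by (auto simp: lorentz_space_def)
  note nn = dr_nonneg[OF c0(1)] dr_nonneg[OF c0(2)]
  let ?a = "\<lambda>j. dr f (B ^ j - 1)" and ?b = "\<lambda>j. dr g (B ^ j - 1)"
  let ?t = "\<lambda>j. (?a j * X.S j) * (?b j * Y.S j)"
  have t: "0 \<le> ?t j" for j
    using nn less_imp_le[OF X.S_pos[of j]] less_imp_le[OF Y.S_pos[of j]]
    by (intro mult_nonneg_nonneg) auto
  have point: "real (B ^ j) * (?a j * ?b j) \<le> A * ?t j" for j
    using mult_right_mono[OF power_le[of j], of "?a j * ?b j"] nn by (simp add: mult_ac)
  have blocks: "(\<Sum>n<B ^ J. dr f n * dr g n) \<le> A * (?t 0 + real B * (\<Sum>j<J. ?t j))" for J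
  proof (induction J)
    case 0
    show ?case using point[of 0] by simp
  next
    case (Suc J)
    have "(\<Sum>n\<in>{B ^ J..<B ^ Suc J}. dr f n * dr g n) \<le> (\<Sum>n\<in>{B ^ J..<B ^ Suc J}. ?a J * ?b J)"
      using nn by (intro sum_mono mult_mono dr_antimono c0) auto
    also have "\<dots> \<le> real (B ^ Suc J) * (?a J * ?b J)"
      unfolding sum_constant card_atLeastLessThan
      using nn by (intro mult_right_mono of_nat_mono diff_le_self mult_nonneg_nonneg)
    also have "\<dots> = real B * (real (B ^ J) * (?a J * ?b J))"
      by simp
    also have "\<dots> \<le> real B * (A * ?t J)"
      by (intro mult_left_mono point) simp
    finally show ?case
      using Suc.IH unfolding X.sum_blocks by (simp add: algebra_simps)
  qed
  have "M < B ^ M"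
    using X.base by (intro power_gt_expt) auto
  then have "(\<Sum>n<M. dr f n * dr g n) \<le> (\<Sum>n<B ^ M. dr f n * dr g n)"
    using nn by (intro sum_mono2) auto
  also have "\<dots> \<le> A * (?t 0 + real B * (\<Sum>j<M. ?t j))"
    by (rule blocks)
  \<comment> \<open>Summing up to \<open>Suc M\<close> ensures that the index 0 is included even
    when \<open>M\<close> is 0.\<close>
  also have "\<dots> \<le> A * ((\<Sum>j<Suc M. ?t j) + real B * (\<Sum>j<Suc M. ?t j))"
  proof (intro mult_left_mono add_mono)
    show "?t 0 \<le> (\<Sum>j<Suc M. ?t j)"
      using t by (intro member_le_sum) auto
    show "(\<Sum>j<M. ?t j) \<le> (\<Sum>j<Suc M. ?t j)"
      using t by simp
  qed (use A in auto)
  also have "\<dots> = (1 + real B) * A * (\<Sum>j<Suc M. ?t j)"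
    by (simp add: algebra_simps)
  also have "\<dots> \<le> (1 + real B) * A * ((K * lorentz_norm q w f) * (K' * lorentz_norm q' w' g))"
  proof (rule mult_left_mono)
    have "(\<Sum>j<Suc M. ?t j) \<le> (\<Sum>j<Suc M. (?a j * X.S j) powr q) powr (1 / q)
        * (\<Sum>j<Suc M. (?b j * Y.S j) powr q') powr (1 / q')"
      using nn less_imp_le[OF X.S_pos] less_imp_le[OF Y.S_pos]
      by (intro Holder_sum q q'_gt_1 conjugate mult_nonneg_nonneg) auto
    also have "\<dots> \<le> (K * lorentz_norm q w f) * (K' * lorentz_norm q' w' g)"
      using X.dyadic_of_lorentz(2)[OF q assms(1), of "Suc M"]
        Y.dyadic_of_lorentz(2)[OF q'_gt_1 assms(2), of "Suc M"] X.K_ge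
      unfolding dyadic_term_def
      by (intro mult_mono) (auto intro!: mult_nonneg_nonneg lorentz_norm_nonneg)
    finally show "(\<Sum>j<Suc M. ?t j) \<le> (K * lorentz_norm q w f) * (K' * lorentz_norm q' w' g)" .
  qed (use A in auto)
  finally show ?thesis by (simp only: mult_ac)
qed

lemma pairing_bound:
  fixes f g :: "nat \<Rightarrow> 'a::{real_normed_field,banach}"
  assumes "f \<in> lorentz_space q w" "g \<in> lorentz_space q' w'"
  shows "summable (\<lambda>k. f k * g k)"
    and "norm (\<Sum>k. f k * g k) \<le> pairing_const * lorentz_norm q' w' g * lorentz_norm q w f"
proof -
  let ?C = "pairing_const * lorentz_norm q' w' g * lorentz_norm q w f"
  have c0: "f \<in> c0" "g \<in> c0"
    using assms by (auto simp: lorentz_space_def)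
  have bound: "(\<Sum>k<n. norm (f k * g k)) \<le> ?C" for n
  proof -
    obtain M where "(\<Sum>k<n. norm (f k * g k)) \<le> 2 * (\<Sum>m<M. dr f m * dr g m)"
      using sum_norm_le_rearrangement[OF c0, of "{..<n}"] by auto
    also have "\<dots> \<le> 2 * ((1 + real B) * A * (K * K') * (lorentz_norm q w f * lorentz_norm q' w' g))"
      by (intro mult_left_mono rearranged_sum_le assms) simp
    also have "\<dots> = ?C"
      by (simp only: pairing_const_def mult_ac)
    finally show ?thesis .
  qed
  have sum: "summable (\<lambda>k. norm (f k * g k))"
    using bound by (intro summableI_nonneg_bounded) auto
  then show "summable (\<lambda>k. f k * g k)"
    by (rule summable_norm_cancel)
  have "norm (\<Sum>k. f k * g k) \<le> (\<Sum>k. norm (f k * g k))"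
    using sum by (rule summable_norm)
  also have "\<dots> \<le> ?C"
    using sum bound by (rule suminf_le_const)
  finally show "norm (\<Sum>k. f k * g k) \<le> ?C" .
qed

section \<open>Lower bounds for functionals by test vectors\<close>

lemma sum_S_powr_le: "(\<Sum>j\<le>i. X.S j powr q) \<le> 2 * X.S i powr q"
proof (induction i)
  case 0
  show ?case by simp
next
  case (Suc i)
  \<comment> \<open>The q-th powers also grow at least by the factor 2, so as in a geometric series
    the last term dominates the sum of all.\<close>
  have "2 * X.S i powr q \<le> 2 powr q * X.S i powr q"
    using powr_mono[of 1 q 2] q by (intro mult_right_mono) auto
  also have "\<dots> = (2 * X.S i) powr q"
    using X.S_pos[of i] by (simp add: powr_mult)
  also have "\<dots> \<le> X.S (Suc i) powr q"
    using X.lower[of i] X.S_pos[of i] q by (intro powr_mono2) auto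
  finally show ?case using Suc by simp
qed

text \<open>The outer 2 arises from comparing initial segments with blocks, the inner 2 from
  \<open>sum_S_powr_le\<close>, and \<open>1 + K powr q\<close> from
  \<open>lorentz_of_dyadic\<close>.\<close>

definition coefficient_const :: real where
  "coefficient_const = 2 * (2 * (1 + K powr q)) powr (1 / q)"

text \<open>The test vector has rearrangement at most \<open>x\<close>, an \<open>\<ell>\<^sub>q\<close>-combination of indicators
  of initial segments: with \<open>q\<close>-th powers, its dyadic norm is computed by exchanging the order of
  summation.  The powers of \<open>v\<close> are those of the equality case of Hoelder's inequality.\<close>

lemma dyadic_functional_bound:
  fixes \<phi> :: "(nat \<Rightarrow> 'a::real_normed_field) \<Rightarrow> 'a"
  assumes \<phi>: "\<phi> \<in> dual_space (lorentz_space q w) N" and C0: "0 \<le> C"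
    and C: "\<And>f. f \<in> lorentz_space q w \<Longrightarrow> norm (\<phi> f) \<le> C * lorentz_norm q w f"
    and inj: "inj \<pi>" and \<gamma>: "antimono \<gamma>" "\<And>n. 0 \<le> \<gamma> n" "\<And>n. \<gamma> n \<le> norm (\<phi> (unit_seq (\<pi> n)))"
  shows "(\<Sum>j\<le>J. (\<gamma> (B ^ j - 1) * real (B ^ j) / X.S j) powr q') powr (1 / q') \<le> coefficient_const * C"
proof -
  \<comment> \<open>As S_j S'_j is comparable to B^j, \<open>v j\<close> is the dyadic quantity of
    \<gamma> for \<open>w'\<close>, expressed through \<open>w\<close> alone.\<close>
  define v where "v j = \<gamma> (B ^ j - 1) * real (B ^ j) / X.S j" for j
  define Z where "Z j = v j powr (q' - 1) / X.S j" for j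
  define x where "x n = (\<Sum>j\<in>{j. j \<le> J \<and> n < B ^ j}. Z j powr q) powr (1 / q)" for n
  define T where "T = (\<Sum>j\<le>J. v j powr q')"
  have v: "0 \<le> v j" for j
    using \<gamma>(2) X.S_pos[of j] by (simp add: v_def)
  have Z: "0 \<le> Z j" for j
    using X.S_pos[of j] by (simp add: Z_def)
  have ZS: "(Z j * X.S j) powr q = v j powr q'" for j
    using X.S_pos[of j] by (simp add: Z_def powr_powr dyadic_exponent)
  have x0: "0 \<le> x n" for n by (simp add: x_def)
  have x_anti: "antimono x"
    unfolding x_def using q
    by (intro antimonoI powr_mono2 sum_mono2) (auto intro: sum_nonneg)
  have x_ge: "Z j \<le> x n" if "j \<le> J" "n < B ^ j" for j n
  proof -
    have "Z j = (Z j powr q) powr (1 / q)"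
      using Z[of j] q by (simp add: powr_powr)
    also have "\<dots> \<le> x n"
      unfolding x_def using that q by (intro powr_mono2 member_le_sum) auto
    finally show ?thesis .
  qed
  have x_zero: "x n = 0" if "B ^ J \<le> n" for n
  proof -
    have "B ^ j \<le> n" if "j \<le> J" for j
      by (rule order_trans[OF power_increasing[OF that] \<open>B ^ J \<le> n\<close>]) (use X.base in simp)
    then have empty: "{j. j \<le> J \<and> n < B ^ j} = {}" by (auto simp: not_less)
    show ?thesis unfolding x_def empty by simp
  qed
  \<comment> \<open>A unimodular factor that turns each coefficient into its modulus; where the
    coefficient is 0 any scalar of norm 1 would do.\<close>
  define u where "u k = (if \<phi> (unit_seq k) = 0 then 1 else of_real (norm (\<phi> (unit_seq k))) / \<phi> (unit_seq k))" for k
  have u: "norm (u k) = 1" "u k * \<phi> (unit_seq k) = of_real (norm (\<phi> (unit_seq k)))" for k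
    by (auto simp: u_def norm_divide)
  define f where "f k = (if k \<in> \<pi> ` {..<B ^ J} then of_real (x (inv \<pi> k)) * u k else 0)" for k
  have f_pi: "norm (f (\<pi> n)) \<le> x n" for n
    using x0[of n] inj by (auto simp: f_def norm_mult u)
  have f_X: "f \<in> lorentz_space q w"
    by (rule lorentz_finite_support, rule finite_subset[of _ "\<pi> ` {..<B ^ J}"]) (auto simp: f_def)
  have f_c0: "f \<in> c0"
    using f_X by (simp add: lorentz_space_def)
  have dr_f: "dr f n \<le> x n" for n
    by (rule dr_le_of_enumeration[of x f \<pi>, OF x_anti x0 f_pi]) (auto simp: f_def)
  have dyadic: "dyadic_term q w B f j \<le> (x (B ^ j - 1) * X.S j) powr q" for j
    unfolding dyadic_term_def using dr_f dr_nonneg[OF f_c0] q X.S_pos[of j]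
    by (intro powr_mono2 mult_right_mono mult_nonneg_nonneg) auto
  have x_dyadic: "(x (B ^ j - 1) * X.S j) powr q = (\<Sum>i\<in>{j..J}. Z i powr q * X.S j powr q)" for j
  proof -
    \<comment> \<open>\<open>B ^ j - 1\<close> is the last of the first \<open>B ^ j\<close>
      positions, so it lies in exactly those initial segments that are at least as long. Only the
      \<open>Z i\<close> with \<open>i\<close> from \<open>j\<close> to \<open>J\<close> therefore
      enter \<open>x\<close> there.\<close>
    have iff: "B ^ j - 1 < B ^ i \<longleftrightarrow> j \<le> i" for i
    proof -
      have "B ^ j - 1 < B ^ i \<longleftrightarrow> B ^ j \<le> B ^ i"
        using X.base by (auto simp: less_eq_Suc_le)
      also have "\<dots> \<longleftrightarrow> j \<le> i"
        using X.base by (intro power_increasing_iff) auto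
      finally show ?thesis .
    qed
    have set: "{i. i \<le> J \<and> B ^ j - 1 < B ^ i} = {j..J}"
      unfolding iff by auto
    have "x (B ^ j - 1) powr q = (\<Sum>i\<in>{j..J}. Z i powr q)"
      unfolding x_def set using q by (simp add: powr_powr sum_nonneg)
    then show ?thesis
      using x0 X.S_pos[of j] by (simp add: powr_mult sum_distrib_right)
  qed
  have dyadic_0: "dyadic_term q w B f j = 0" if "j \<notin> {..J}" for j
    using dyadic[of j] that unfolding x_dyadic by (simp add: order_antisym)
  have "(\<Sum>j. dyadic_term q w B f j) = (\<Sum>j\<le>J. dyadic_term q w B f j)"
    by (rule suminf_finite) (auto intro: dyadic_0)
  also have "\<dots> \<le> (\<Sum>j\<le>J. \<Sum>i\<in>{j..J}. Z i powr q * X.S j powr q)"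
    by (rule sum_mono) (use dyadic x_dyadic in metis)
  also have "\<dots> = (\<Sum>i\<le>J. \<Sum>j\<le>i. Z i powr q * X.S j powr q)"
  proof -
    have "(\<Sum>j\<le>J. \<Sum>i\<in>{j..J}. Z i powr q * X.S j powr q)
        = (\<Sum>j\<in>{..J}. \<Sum>i\<in>{i \<in> {..J}. j \<le> i}. Z i powr q * X.S j powr q)"
      by (intro sum.cong refl) auto
    also have "\<dots> = (\<Sum>i\<in>{..J}. \<Sum>j\<in>{j \<in> {..J}. j \<le> i}. Z i powr q * X.S j powr q)"
      by (rule sum.swap_restrict) simp_all
    also have "\<dots> = (\<Sum>i\<le>J. \<Sum>j\<le>i. Z i powr q * X.S j powr q)"
      by (intro sum.cong refl) auto
    finally show ?thesis .
  qed
  also have "\<dots> \<le> (\<Sum>i\<le>J. 2 * v i powr q')"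
  proof (rule sum_mono)
    fix i
    have "(\<Sum>j\<le>i. Z i powr q * X.S j powr q) \<le> Z i powr q * (2 * X.S i powr q)"
      unfolding sum_distrib_left[symmetric] by (intro mult_left_mono sum_S_powr_le) simp
    also have "\<dots> = 2 * v i powr q'"
      using Z[of i] X.S_pos[of i] by (simp add: ZS[symmetric] powr_mult)
    finally show "(\<Sum>j\<le>i. Z i powr q * X.S j powr q) \<le> 2 * v i powr q'" .
  qed
  also have "\<dots> = 2 * T"
    by (simp add: T_def sum_distrib_left)
  finally have dyadic_sum: "(\<Sum>j. dyadic_term q w B f j) \<le> 2 * T" .
  have norm_f: "lorentz_norm q w f \<le> (2 * (1 + K powr q) * T) powr (1 / q)"
    unfolding lorentz_norm_def
  proof (rule powr_mono2)
    show "0 \<le> (\<Sum>n. lorentz_term q w f n)"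
      using f_X by (intro suminf_nonneg lorentz_term_nonneg X.weight) (simp add: lorentz_space_def)
    have "(\<Sum>n. lorentz_term q w f n) \<le> (1 + K powr q) * (\<Sum>j. dyadic_term q w B f j)"
      by (rule X.lorentz_of_dyadic(2)[OF f_c0 q summable_finite[of "{..J}"]]) (auto intro: dyadic_0)
    also have "\<dots> \<le> (1 + K powr q) * (2 * T)"
      by (intro mult_left_mono dyadic_sum) (simp add: add_nonneg_nonneg)
    finally show "(\<Sum>n. lorentz_term q w f n) \<le> 2 * (1 + K powr q) * T"
      by (simp add: mult_ac)
  qed (use q in simp)
  have vZ: "v j powr q' = real (B ^ j) * (Z j * \<gamma> (B ^ j - 1))" for j
  proof -
    have "v j powr q' = v j powr (1 + (q' - 1))" by simp
    also have "\<dots> = v j * v j powr (q' - 1)"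
      unfolding powr_add using v[of j] by simp
    also have "\<dots> = real (B ^ j) * (Z j * \<gamma> (B ^ j - 1))"
      by (simp add: Z_def v_def)
    finally show ?thesis .
  qed
  \<comment> \<open>Initial segments overlap, blocks do not. The block ending at B^(M+1) contains at
    least half of the first B^(M+1) positions, and on it \<open>x\<close> is at least
    \<open>Z (Suc M)\<close> and \<gamma> at least its value at the end; hence the factor 2.\<close>
  have low: "(\<Sum>j\<le>M. v j powr q') \<le> 2 * (\<Sum>n<B ^ M. x n * \<gamma> n)" if "M \<le> J" for M
    using that
  proof (induction M)
    case 0
    have "v 0 powr q' = \<gamma> 0 * Z 0"
      by (simp add: vZ)
    also have "\<dots> \<le> \<gamma> 0 * x 0"
      by (intro mult_left_mono x_ge \<gamma>) auto
    finally show ?case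
      using mult_nonneg_nonneg[OF x0[of 0] \<gamma>(2)[of 0]] by (simp add: mult_ac)
  next
    case (Suc M)
    let ?m = "B ^ Suc M"
    have "v (Suc M) powr q' = real ?m * (Z (Suc M) * \<gamma> (?m - 1))"
      by (rule vZ)
    also have "\<dots> \<le> (2 * real (?m - B ^ M)) * (Z (Suc M) * \<gamma> (?m - 1))"
    proof (rule mult_right_mono)
      have "2 * B ^ M \<le> ?m" using X.base by simp
      then have "?m \<le> 2 * (?m - B ^ M)" by linarith
      then show "real ?m \<le> 2 * real (?m - B ^ M)" by linarith
    qed (use Z \<gamma>(2) in simp)
    also have "\<dots> = 2 * (\<Sum>n\<in>{B ^ M..<?m}. Z (Suc M) * \<gamma> (?m - 1))"
      by simp
    also have "\<dots> \<le> 2 * (\<Sum>n\<in>{B ^ M..<?m}. x n * \<gamma> n)"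
    proof (intro mult_left_mono sum_mono mult_mono)
      fix n assume n: "n \<in> {B ^ M..<?m}"
      show "Z (Suc M) \<le> x n" using Suc.prems n by (intro x_ge) auto
      show "\<gamma> (?m - 1) \<le> \<gamma> n" using n by (intro antimonoD[OF \<gamma>(1)]) auto
    qed (use x0 \<gamma>(2) in auto)
    finally show ?case
      using Suc unfolding X.sum_blocks by simp
  qed
  have "(\<Sum>n<B ^ J. x n * \<gamma> n) \<le> (\<Sum>n<B ^ J. x n * norm (\<phi> (unit_seq (\<pi> n))))"
    by (intro sum_mono mult_left_mono \<gamma> x0)
  also have "\<dots> = norm (\<phi> f)"
  proof -
    have "\<phi> f = (\<Sum>k\<in>\<pi> ` {..<B ^ J}. of_real (x (inv \<pi> k)) * u k * \<phi> (unit_seq k))"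
      using dual_space_finite_support[OF \<phi>, of "\<pi> ` {..<B ^ J}" "\<lambda>k. of_real (x (inv \<pi> k)) * u k"]
      by (simp add: f_def[abs_def])
    also have "\<dots> = (\<Sum>n<B ^ J. of_real (x n) * (u (\<pi> n) * \<phi> (unit_seq (\<pi> n))))"
      using inj by (subst sum.reindex) (auto simp: inj_on_subset[OF inj] mult.assoc)
    also have "\<dots> = of_real (\<Sum>n<B ^ J. x n * norm (\<phi> (unit_seq (\<pi> n))))"
      by (simp add: u)
    finally show ?thesis
      using x0 by (simp add: abs_of_nonneg sum_nonneg del: of_real_sum of_real_mult)
  qed
  also have "\<dots> \<le> C * lorentz_norm q w f"
    by (rule C[OF f_X])
  finally have main: "T \<le> 2 * (C * lorentz_norm q w f)"
    using low[of J] by (simp add: T_def)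
  have T0: "0 \<le> T" by (simp add: T_def sum_nonneg)
  have "T powr (1 / q') \<le> coefficient_const * C"
  proof (cases "T = 0")
    case True
    then show ?thesis using C0 by (simp add: coefficient_const_def)
  next
    case False
    with T0 have T: "0 < T" by auto
    \<comment> \<open>\<open>T\<close> also bounds the norm of the test vector, to the power 1/q.
      Being a finite sum, it can be divided out, which leaves the power 1 - 1/q = 1/q'. The
      resulting bound does not depend on \<open>J\<close>.\<close>
    have "T \<le> 2 * (C * (2 * (1 + K powr q) * T) powr (1 / q))"
      using main norm_f mult_left_mono[OF norm_f C0] by linarith
    also have "\<dots> = coefficient_const * C * T powr (1 / q)"
      using T by (simp add: coefficient_const_def powr_mult add_nonneg_nonneg mult_ac)
    finally have "T / T powr (1 / q) \<le> coefficient_const * C"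
      using T by (simp add: divide_le_eq)
    moreover have "T / T powr (1 / q) = T powr (1 / q')"
    proof -
      have "1 / q' = 1 - 1 / q" using conjugate by linarith
      then show ?thesis using T by (simp add: powr_diff)
    qed
    ultimately show ?thesis by simp
  qed
  then show ?thesis
    by (simp add: T_def v_def)
qed

end

section \<open>Coefficients of bounded functionals as elements of the second space\<close>

context dual_regular_weights
begin

text \<open>The bound S'_j <= A B^j / S_j transfers the previous estimate to \<open>w'\<close>.
  Stating it for a minorant \<gamma> along any injection, instead of for the rearranged
  coefficients, makes it applicable before the coefficients are known to tend to 0.\<close>

lemma functional_bound:
  fixes \<phi> :: "(nat \<Rightarrow> 'a::real_normed_field) \<Rightarrow> 'a"
  assumes \<phi>: "\<phi> \<in> dual_space (lorentz_space q w) N" and C0: "0 \<le> C"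
    and C: "\<And>f. f \<in> lorentz_space q w \<Longrightarrow> norm (\<phi> f) \<le> C * lorentz_norm q w f"
    and inj: "inj \<pi>" and \<gamma>: "antimono \<gamma>" "\<And>n. 0 \<le> \<gamma> n" "\<And>n. \<gamma> n \<le> norm (\<phi> (unit_seq (\<pi> n)))"
  shows "(\<Sum>j\<le>J. (\<gamma> (B ^ j - 1) * Y.S j) powr q') powr (1 / q') \<le> A * (coefficient_const * C)"
proof -
  let ?v = "\<lambda>j. \<gamma> (B ^ j - 1) * real (B ^ j) / X.S j"
  have v: "0 \<le> ?v j" for j
    using \<gamma>(2) X.S_pos[of j] by simp
  have "(\<gamma> (B ^ j - 1) * Y.S j) powr q' \<le> A powr q' * ?v j powr q'" for j
  proof -
    have "Y.S j \<le> A * (real (B ^ j) / X.S j)"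
      using le_power[of j] X.S_pos[of j] by (simp add: field_simps)
    then have "\<gamma> (B ^ j - 1) * Y.S j \<le> \<gamma> (B ^ j - 1) * (A * (real (B ^ j) / X.S j))"
      by (intro mult_left_mono \<gamma>)
    then have "\<gamma> (B ^ j - 1) * Y.S j \<le> A * ?v j"
      by (simp add: mult_ac)
    then have "(\<gamma> (B ^ j - 1) * Y.S j) powr q' \<le> (A * ?v j) powr q'"
      using \<gamma>(2) Y.S_pos[of j] q'_gt_1 by (intro powr_mono2) auto
    also have "\<dots> = A powr q' * ?v j powr q'"
      by (rule powr_mult)
    finally show ?thesis .
  qed
  then have "(\<Sum>j\<le>J. (\<gamma> (B ^ j - 1) * Y.S j) powr q') \<le> A powr q' * (\<Sum>j\<le>J. ?v j powr q')"
    unfolding sum_distrib_left by (rule sum_mono)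
  then have "(\<Sum>j\<le>J. (\<gamma> (B ^ j - 1) * Y.S j) powr q') powr (1 / q')
      \<le> (A powr q' * (\<Sum>j\<le>J. ?v j powr q')) powr (1 / q')"
    using q'_gt_1 by (intro powr_mono2 sum_nonneg) auto
  also have "\<dots> = A * (\<Sum>j\<le>J. ?v j powr q') powr (1 / q')"
    using A q'_gt_1 by (simp add: powr_mult sum_nonneg powr_powr)
  also have "\<dots> \<le> A * (coefficient_const * C)"
    using A by (intro mult_left_mono dyadic_functional_bound[OF \<phi> C0 C inj \<gamma>]) auto
  finally show ?thesis .
qed

text \<open>With the constant minorant \<open>e\<close>, \<open>functional_bound\<close> would bound
  e S'_j uniformly in j, although S'_j grows at least like 2^j.\<close>

lemma coefficients_c0:
  fixes \<phi> :: "(nat \<Rightarrow> 'a::real_normed_field) \<Rightarrow> 'a"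
  assumes \<phi>: "\<phi> \<in> dual_space (lorentz_space q w) N" and C0: "0 \<le> C"
    and C: "\<And>f. f \<in> lorentz_space q w \<Longrightarrow> norm (\<phi> f) \<le> C * lorentz_norm q w f"
  shows "(\<lambda>k. \<phi> (unit_seq k)) \<in> c0"
proof (rule ccontr)
  assume "(\<lambda>k. \<phi> (unit_seq k)) \<notin> c0"
  then obtain e where e: "0 < e" "\<not> eventually (\<lambda>k. norm (\<phi> (unit_seq k)) < e) sequentially"
    by (auto simp: c0_def tendsto_iff)
  let ?I = "{k. e \<le> norm (\<phi> (unit_seq k))}"
  have inf: "infinite ?I"
    using e(2) by (auto simp: eventually_sequentially not_less finite_nat_set_iff_bounded_le)
      (metis nat_le_linear not_less_eq_eq)
  define \<pi> where "\<pi> = enumerate ?I"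
  have \<pi>: "inj \<pi>" "\<And>n. e \<le> norm (\<phi> (unit_seq (\<pi> n)))"
    using strict_mono_imp_inj_on[OF strict_mono_enumerate[OF inf]] enumerate_in_set[OF inf]
    by (auto simp: \<pi>_def)
  let ?D = "A * (coefficient_const * C)"
  have bound: "e * Y.S j \<le> ?D" for j
  proof -
    have "e * Y.S j = ((e * Y.S j) powr q') powr (1 / q')"
      using e Y.S_pos[of j] q'_gt_1 by (simp add: powr_powr)
    also have "\<dots> \<le> (\<Sum>i\<le>j. (e * Y.S i) powr q') powr (1 / q')"
      using q'_gt_1 by (intro powr_mono2 member_le_sum) auto
    also have "\<dots> \<le> ?D"
      using functional_bound[OF \<phi> C0 C \<pi>(1), of "\<lambda>_. e" j] e(1) \<pi>(2) by (simp add: monotone_def)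
    finally show ?thesis .
  qed
  have grow: "2 ^ j * Y.S 0 \<le> Y.S j" for j
  proof (induction j)
    case (Suc j)
    then show ?case using Y.lower[of j] by simp
  qed simp
  have pos: "0 < e * Y.S 0" using e Y.S_pos[of 0] by simp
  obtain j where j: "?D / (e * Y.S 0) < 2 ^ j"
    using real_arch_pow[of 2 "?D / (e * Y.S 0)"] by auto
  then have "?D < 2 ^ j * (e * Y.S 0)"
    using pos by (simp add: divide_less_eq)
  also have "\<dots> = e * (2 ^ j * Y.S 0)" by simp
  also have "\<dots> \<le> e * Y.S j"
    using e(1) by (intro mult_left_mono grow) simp
  finally show False
    using bound[of j] by simp
qed

definition dual_const :: real where
  "dual_const = (1 + K' powr q') powr (1 / q') * (A * coefficient_const)"

lemma dual_const_pos: "0 < dual_const"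
proof -
  have "0 < 1 + K' powr q'" "0 < 1 + K powr q" by (simp_all add: add_pos_nonneg)
  then show ?thesis
    using A by (auto simp: dual_const_def coefficient_const_def)
qed

text \<open>Now the minorant is the rearrangement of the coefficients itself, attained along the
  decreasing enumeration. Since the bound is uniform in \<open>J\<close>, the dyadic series for
  \<open>w'\<close> converges and controls the Lorentz norm.\<close>

lemma coefficients_lorentz:
  fixes \<phi> :: "(nat \<Rightarrow> 'a::real_normed_field) \<Rightarrow> 'a"
  assumes \<phi>: "\<phi> \<in> dual_space (lorentz_space q w) N" and C0: "0 \<le> C"
    and C: "\<And>f. f \<in> lorentz_space q w \<Longrightarrow> norm (\<phi> f) \<le> C * lorentz_norm q w f"
  shows "(\<lambda>k. \<phi> (unit_seq k)) \<in> lorentz_space q' w'"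
    and "lorentz_norm q' w' (\<lambda>k. \<phi> (unit_seq k)) \<le> dual_const * C"
proof -
  define g where "g k = \<phi> (unit_seq k)" for k
  have c0: "g \<in> c0"
    unfolding g_def[abs_def] by (rule coefficients_c0[OF \<phi> C0 C])
  obtain \<pi> where \<pi>: "inj \<pi>" "\<forall>n. norm (g (\<pi> n)) = dr g n"
    using decreasing_enumeration[OF c0] by auto
  let ?D = "A * (coefficient_const * C)"
  have D: "0 \<le> ?D"
    using A C0 by (simp add: coefficient_const_def)
  have le: "dr g n \<le> norm (\<phi> (unit_seq (\<pi> n)))" for n
    using \<pi>(2) by (simp add: g_def)
  have anti: "antimono (dr g)"
    using c0 by (intro antimonoI dr_antimono)
  have bound: "(\<Sum>j\<le>J. dyadic_term q' w' B g j) powr (1 / q') \<le> ?D" for J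
    unfolding dyadic_term_def by (rule functional_bound[OF \<phi> C0 C \<pi>(1) anti dr_nonneg[OF c0] le])
  have bound': "(\<Sum>j<J. dyadic_term q' w' B g j) \<le> ?D powr q'" for J
  proof -
    have "(\<Sum>j<J. dyadic_term q' w' B g j) \<le> (\<Sum>j\<le>J. dyadic_term q' w' B g j)"
      by (intro sum_mono2) auto
    also have "\<dots> = ((\<Sum>j\<le>J. dyadic_term q' w' B g j) powr (1 / q')) powr q'"
      using q'_gt_1 by (simp add: powr_powr sum_nonneg)
    also have "\<dots> \<le> ?D powr q'"
      using bound q'_gt_1 by (intro powr_mono2) auto
    finally show ?thesis .
  qed
  have sum: "summable (dyadic_term q' w' B g)"
    by (rule summableI_nonneg_bounded[OF _ bound']) simp
  have suminf: "(\<Sum>j. dyadic_term q' w' B g j) \<le> ?D powr q'"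
    by (rule suminf_le_const[OF sum bound'])
  show X: "(\<lambda>k. \<phi> (unit_seq k)) \<in> lorentz_space q' w'"
    using Y.lorentz_of_dyadic(1)[OF c0 q'_gt_1 sum] by (simp add: g_def[abs_def])
  have nonneg: "0 \<le> (\<Sum>n. lorentz_term q' w' g n)"
    using X by (intro suminf_nonneg lorentz_term_nonneg Y.weight) (simp add: lorentz_space_def g_def[abs_def])
  have "(\<Sum>n. lorentz_term q' w' g n) \<le> (1 + K' powr q') * (\<Sum>j. dyadic_term q' w' B g j)"
    by (rule Y.lorentz_of_dyadic(2)[OF c0 q'_gt_1 sum])
  also have "\<dots> \<le> (1 + K' powr q') * ?D powr q'"
    by (intro mult_left_mono suminf) (simp add: add_nonneg_nonneg)
  finally have "lorentz_norm q' w' g \<le> ((1 + K' powr q') * ?D powr q') powr (1 / q')"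
    unfolding lorentz_norm_def using q'_gt_1 nonneg by (intro powr_mono2) auto
  also have "\<dots> = (1 + K' powr q') powr (1 / q') * (?D powr q') powr (1 / q')"
    by (rule powr_mult)
  also have "(?D powr q') powr (1 / q') = ?D"
    using D q'_gt_1 unfolding powr_powr by simp
  finally have "lorentz_norm q' w' g \<le> (1 + K' powr q') powr (1 / q') * ?D" .
  also have "\<dots> = dual_const * C"
    by (simp add: dual_const_def)
  finally show "lorentz_norm q' w' (\<lambda>k. \<phi> (unit_seq k)) \<le> dual_const * C"
    by (simp add: g_def[abs_def])
qed

section \<open>The pairing as a bijection onto the dual\<close>

abbreviation pairing :: "(nat \<Rightarrow> 'a::{real_normed_field,banach}) \<Rightarrow> (nat \<Rightarrow> 'a) \<Rightarrow> 'a" where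
  "pairing \<equiv> pairing_functional (lorentz_space q w)"

lemma pairing_unit_seq:
  fixes g :: "nat \<Rightarrow> 'a::{real_normed_field,banach}"
  shows "pairing g (unit_seq k) = g k"
proof -
  have "(unit_seq k :: nat \<Rightarrow> 'a) \<in> lorentz_space q w"
    by (rule lorentz_finite_support) (simp add: unit_seq_def)
  then have "pairing g (unit_seq k) = (\<Sum>n. unit_seq k n * g n)"
    by (simp add: pairing_functional_def)
  also have "\<dots> = (\<Sum>n\<in>{k}. unit_seq k n * g n)"
    by (rule suminf_finite) (auto simp: unit_seq_def)
  finally show ?thesis by (simp add: unit_seq_def)
qed

lemma pairing_in_dual_space:
  fixes g :: "nat \<Rightarrow> 'a::{real_normed_field,banach}"
  assumes g: "g \<in> lorentz_space q' w'"
  shows "pairing g \<in> dual_space (lorentz_space q w) (lorentz_norm q w)"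
  unfolding dual_space_def mem_Collect_eq
proof (intro conjI ballI allI)
  show "pairing g \<in> extensional (lorentz_space q w)"
    by (simp add: pairing_functional_def)
next
  fix f h :: "nat \<Rightarrow> 'a"
  assume f: "f \<in> lorentz_space q w" and h: "h \<in> lorentz_space q w"
  \<comment> \<open>The functional is \<open>undefined\<close> outside the space, so besides
    convergence of both series the sum has to lie in the space.\<close>
  show "pairing g (\<lambda>n. f n + h n) = pairing g f + pairing g h"
    using f h X.lorentz_space_add[OF q f h]
      suminf_add[OF pairing_bound(1)[OF f g] pairing_bound(1)[OF h g]]
    by (simp add: pairing_functional_def distrib_right)
next
  fix c :: 'a and f :: "nat \<Rightarrow> 'a"
  assume f: "f \<in> lorentz_space q w"
  show "pairing g (\<lambda>n. c * f n) = c * pairing g f"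
    using f lorentz_scale(1)[OF _ X.weight f, of c] q suminf_mult[OF pairing_bound(1)[OF f g], of c]
    by (simp add: pairing_functional_def mult.assoc)
next
  show "\<exists>C. \<forall>f\<in>lorentz_space q w. norm (pairing g f) \<le> C * lorentz_norm q w f"
    using pairing_bound(2)[OF _ g]
    by (intro exI[of _ "pairing_const * lorentz_norm q' w' g"]) (simp add: pairing_functional_def)
qed

text \<open>Finitely supported sequences are dense, so a bounded functional is determined by its
  coefficients.\<close>

lemma functional_eq_pairing:
  fixes \<phi> :: "(nat \<Rightarrow> 'a::{real_normed_field,banach}) \<Rightarrow> 'a"
  assumes \<phi>: "\<phi> \<in> dual_space (lorentz_space q w) (lorentz_norm q w)"
    and g: "(\<lambda>k. \<phi> (unit_seq k)) \<in> lorentz_space q' w'"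
  shows "\<phi> = pairing (\<lambda>k. \<phi> (unit_seq k))"
proof (rule extensionalityI[of _ "lorentz_space q w"])
  show "\<phi> \<in> extensional (lorentz_space q w)"
    using \<phi> by (simp add: dual_space_def)
  show "pairing (\<lambda>k. \<phi> (unit_seq k)) \<in> extensional (lorentz_space q w)"
    by (simp add: pairing_functional_def)
  fix f :: "nat \<Rightarrow> 'a"
  assume f: "f \<in> lorentz_space q w"
  obtain C where C: "\<forall>f\<in>lorentz_space q w. norm (\<phi> f) \<le> C * lorentz_norm q w f"
    using \<phi> by (auto simp: dual_space_def)
  define tail where "tail N = (\<lambda>k. if N \<le> k then f k else 0)" for N
  have tail: "tail N \<in> lorentz_space q w" for N
  proof (rule lorentz_mono(1)[OF _ X.weight f])
    have "f \<longlonglongrightarrow> 0" using f by (simp add: lorentz_space_def c0_def)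
    then show "tail N \<in> c0"
      unfolding c0_def mem_Collect_eq
      by (rule Lim_null_comparison[rotated, OF tendsto_norm_zero]) (simp add: tail_def)
  qed (use q in \<open>auto simp: tail_def\<close>)
  have split: "\<phi> f - \<phi> (tail N) = (\<Sum>k<N. f k * \<phi> (unit_seq k))" for N
  proof -
    let ?h = "\<lambda>k. if k \<in> {..<N} then f k else 0"
    have h: "?h \<in> lorentz_space q w"
      by (rule lorentz_finite_support, rule finite_subset[of _ "{..<N}"]) auto
    have "f = (\<lambda>k. ?h k + tail N k)"
      by (auto simp: tail_def)
    moreover have "\<phi> (\<lambda>k. ?h k + tail N k) = \<phi> ?h + \<phi> (tail N)"
      using \<phi> h tail unfolding dual_space_def by fast
    ultimately have "\<phi> f = \<phi> ?h + \<phi> (tail N)" by simp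
    then show ?thesis
      using dual_space_finite_support[OF \<phi>, of "{..<N}" f] by simp
  qed
  have "(\<lambda>N. \<phi> (tail N)) \<longlonglongrightarrow> 0"
  proof (rule Lim_null_comparison)
    show "eventually (\<lambda>N. norm (\<phi> (tail N)) \<le> C * lorentz_norm q w (tail N)) sequentially"
      using C tail by simp
    show "(\<lambda>N. C * lorentz_norm q w (tail N)) \<longlonglongrightarrow> 0"
      unfolding tail_def
      by (intro tendsto_mult_right_zero lorentz_tail_tendsto_0 q X.weight f)
  qed
  then have "(\<lambda>N. \<phi> f - \<phi> (tail N)) \<longlonglongrightarrow> \<phi> f - 0"
    by (intro tendsto_diff tendsto_const)
  then have "(\<lambda>k. f k * \<phi> (unit_seq k)) sums \<phi> f"
    by (simp add: split sums_def)
  then show "\<phi> f = pairing (\<lambda>k. \<phi> (unit_seq k)) f"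
    using f by (simp add: pairing_functional_def sums_unique)
qed

section \<open>The dual norm as the least bound of a functional\<close>

lemma dual_norm_le:
  fixes \<phi> :: "(nat \<Rightarrow> 'a::real_normed_field) \<Rightarrow> 'a"
  assumes "0 \<le> C" "\<And>f. f \<in> lorentz_space q w \<Longrightarrow> norm (\<phi> f) \<le> C * lorentz_norm q w f"
  shows "bdd_above ((\<lambda>f. norm (\<phi> f)) ` {f \<in> lorentz_space q w. lorentz_norm q w f \<le> 1})"
    and "dual_norm (lorentz_space q w) (lorentz_norm q w) \<phi> \<le> C"
proof -
  have le: "norm (\<phi> f) \<le> C" if "f \<in> {f \<in> lorentz_space q w. lorentz_norm q w f \<le> 1}" for f
    using assms(2)[of f] mult_left_mono[of "lorentz_norm q w f" 1 C] assms(1) that by auto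
  then show "bdd_above ((\<lambda>f. norm (\<phi> f)) ` {f \<in> lorentz_space q w. lorentz_norm q w f \<le> 1})"
    by (intro bdd_aboveI[of _ C]) auto
  \<comment> \<open>The supremum over the unit ball is meaningful only if the ball is non-empty; the
    zero sequence witnesses this.\<close>
  have zero: "(\<lambda>k. 0::'a) \<in> lorentz_space q w"
    by (rule lorentz_finite_support) simp
  have "lorentz_norm q w (\<lambda>k. 0::'a) = 0"
    using lorentz_scale(2)[OF _ X.weight zero, of 0] q by simp
  with zero have "{f :: nat \<Rightarrow> 'a. f \<in> lorentz_space q w \<and> lorentz_norm q w f \<le> 1} \<noteq> {}"
    by (metis (mono_tags, lifting) empty_Collect_eq zero_le_one)
  then show "dual_norm (lorentz_space q w) (lorentz_norm q w) \<phi> \<le> C"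
    unfolding dual_norm_def using le by (intro cSUP_least) auto
qed

text \<open>A sequence of positive quasi-norm is scaled into the unit ball. If the quasi-norm is 0,
  the bound contained in membership in the dual forces the functional to vanish there.\<close>

lemma norm_le_dual_norm:
  fixes \<phi> :: "(nat \<Rightarrow> 'a::real_normed_field) \<Rightarrow> 'a"
  assumes \<phi>: "\<phi> \<in> dual_space (lorentz_space q w) (lorentz_norm q w)"
  shows "0 \<le> dual_norm (lorentz_space q w) (lorentz_norm q w) \<phi>"
    and "f \<in> lorentz_space q w \<Longrightarrow>
      norm (\<phi> f) \<le> dual_norm (lorentz_space q w) (lorentz_norm q w) \<phi> * lorentz_norm q w f"
proof -
  let ?D = "dual_norm (lorentz_space q w) (lorentz_norm q w) \<phi>"
  obtain C where C: "\<forall>f\<in>lorentz_space q w. norm (\<phi> f) \<le> C * lorentz_norm q w f"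
    using \<phi> by (auto simp: dual_space_def)
  \<comment> \<open>The bound in \<open>dual_space\<close> has no prescribed sign, while
    \<open>dual_norm_le\<close> asks for a non-negative one.\<close>
  have C': "norm (\<phi> f) \<le> \<bar>C\<bar> * lorentz_norm q w f" if "f \<in> lorentz_space q w" for f
    using C that mult_right_mono[OF abs_ge_self[of C] lorentz_norm_nonneg[of q w f]] by force
  have unit_ball: "norm (\<phi> f) \<le> ?D" if "f \<in> lorentz_space q w" "lorentz_norm q w f \<le> 1" for f
    unfolding dual_norm_def
    by (rule cSUP_upper[OF _ dual_norm_le(1)[OF abs_ge_zero C']]) (use that in auto)
  have scale: "\<phi> (\<lambda>n. c * f n) = c * \<phi> f" if "f \<in> lorentz_space q w" for c f
    using \<phi> that by (simp add: dual_space_def)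
  have zero: "(\<lambda>k. 0::'a) \<in> lorentz_space q w"
    by (rule lorentz_finite_support) simp
  have "lorentz_norm q w (\<lambda>k. 0::'a) = 0"
    using lorentz_scale(2)[OF _ X.weight zero, of 0] q by simp
  from order_trans[OF norm_ge_zero unit_ball[OF zero]] this show "0 \<le> ?D" by simp
  assume f: "f \<in> lorentz_space q w"
  show "norm (\<phi> f) \<le> ?D * lorentz_norm q w f"
  proof (cases "lorentz_norm q w f = 0")
    case True
    then show ?thesis using C f by fastforce
  next
    case False
    then have N: "0 < lorentz_norm q w f"
      using lorentz_norm_nonneg[of q w f] by simp
    let ?c = "of_real (inverse (lorentz_norm q w f)) :: 'a"
    have "norm (\<phi> (\<lambda>n. ?c * f n)) \<le> ?D"
      using lorentz_scale[OF _ X.weight f, of ?c] q N by (intro unit_ball) (auto simp: norm_inverse)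
    then have "inverse (lorentz_norm q w f) * norm (\<phi> f) \<le> ?D"
      using N by (simp only: scale[OF f] norm_mult norm_of_real) simp
    then show ?thesis
      using N by (simp add: field_simps)
  qed
qed

text \<open>The inverse of the pairing reads off the coefficients on the unit sequences. The lower
  norm bound is \<open>coefficients_lorentz\<close> with the dual norm itself in the place of
  \<open>C\<close>.\<close>

theorem dual_is_lorentz:
  "dual_is (lorentz_space q w :: (nat \<Rightarrow> 'a::{real_normed_field,banach}) set) (lorentz_norm q w)
    (lorentz_space q' w') (lorentz_norm q' w')"
  unfolding dual_is_def
proof (intro conjI)
  let ?X = "lorentz_space q w :: (nat \<Rightarrow> 'a) set"
  let ?dn = "dual_norm ?X (lorentz_norm q w)"
  show "\<forall>g\<in>lorentz_space q' w'. \<forall>f\<in>?X. summable (\<lambda>n. f n * g n)"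
    by (intro ballI pairing_bound(1))
  show "bij_betw (pairing_functional ?X) (lorentz_space q' w') (dual_space ?X (lorentz_norm q w))"
  proof (rule bij_betwI[where g = "\<lambda>\<phi> k. \<phi> (unit_seq k)"])
    show "pairing_functional ?X \<in> lorentz_space q' w' \<rightarrow> dual_space ?X (lorentz_norm q w)"
      using pairing_in_dual_space by blast
    have coeff: "(\<lambda>k. \<phi> (unit_seq k)) \<in> lorentz_space q' w'" if "\<phi> \<in> dual_space ?X (lorentz_norm q w)" for \<phi>
      using coefficients_lorentz(1)[OF that norm_le_dual_norm[OF that]] .
    then show "(\<lambda>\<phi> k. \<phi> (unit_seq k)) \<in> dual_space ?X (lorentz_norm q w) \<rightarrow> lorentz_space q' w'"
      by blast
    show "(\<lambda>k. pairing_functional ?X g (unit_seq k)) = g" if "g \<in> lorentz_space q' w'" for g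
      by (simp add: pairing_unit_seq)
    show "pairing_functional ?X (\<lambda>k. \<phi> (unit_seq k)) = \<phi>" if "\<phi> \<in> dual_space ?X (lorentz_norm q w)" for \<phi>
      by (rule functional_eq_pairing[OF that coeff[OF that], symmetric])
  qed
  have upper: "?dn (pairing g) \<le> pairing_const * lorentz_norm q' w' g" if g: "g \<in> lorentz_space q' w'" for g
    using pairing_bound(2)[OF _ g] pairing_const_pos
    by (intro dual_norm_le(2) mult_nonneg_nonneg lorentz_norm_nonneg) (auto simp: pairing_functional_def)
  have "lorentz_norm q' w' g \<le> dual_const * ?dn (pairing g)" if g: "g \<in> lorentz_space q' w'" for g
    using coefficients_lorentz(2)[OF pairing_in_dual_space[OF g] norm_le_dual_norm[OF pairing_in_dual_space[OF g]]]
    by (simp add: pairing_unit_seq)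
  then have lower: "(1 / dual_const) * lorentz_norm q' w' g \<le> ?dn (pairing g)"
    if "g \<in> lorentz_space q' w'" for g
    using that dual_const_pos by (simp add: field_simps)
  show "\<exists>c>0. \<exists>C>0. \<forall>g\<in>lorentz_space q' w'.
      c * lorentz_norm q' w' g \<le> ?dn (pairing g) \<and> ?dn (pairing g) \<le> C * lorentz_norm q' w' g"
    using lower upper dual_const_pos pairing_const_pos
    by (intro exI[of _ "1 / dual_const"] exI[of _ pairing_const] conjI ballI) simp_all
qed

end

section \<open>Regularity of the primitive sequences\<close>

lemma URP_power:
  assumes "\<forall>n\<ge>1. t (b * n) \<le> real b / 2 * t n" "2 \<le> b" "1 \<le> n"
  shows "t (b ^ k * n) \<le> (real b / 2) ^ k * t n"
proof (induction k)
  case (Suc k)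
  have "1 \<le> b ^ k * n"
    using assms(2,3) by simp
  then have "t (b * (b ^ k * n)) \<le> real b / 2 * t (b ^ k * n)"
    using assms(1) by blast
  also have "\<dots> \<le> real b / 2 * ((real b / 2) ^ k * t n)"
    using Suc by (intro mult_left_mono) auto
  finally show ?case by (simp add: mult_ac)
qed simp

text \<open>Let n lie between b^i k and b^(i+1) k. Then s_n <= b^(i+1) s_k by iterated URP, while
  b^i k <= n, so k/s_k <= b^(i+1) k/s_n <= b n/s_n.\<close>

lemma dual_seq_almost_mono:
  assumes w: "weight w" and b: "2 \<le> b" "\<forall>n\<ge>1. primitive w (b * n) \<le> real b / 2 * primitive w n"
    and "1 \<le> k" "k \<le> n"
  shows "dual_seq (primitive w) k \<le> real b * dual_seq (primitive w) n"
proof -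
  let ?m = "LEAST i. n < b ^ i * k"
  have "n < b ^ n" using b by (intro power_gt_expt) auto
  also have "\<dots> \<le> b ^ n * k" using \<open>1 \<le> k\<close> by simp
  finally have m: "n < b ^ ?m * k"
    by (rule LeastI)
  then have "?m \<noteq> 0" using \<open>k \<le> n\<close> by (metis mult_1 not_less power_0)
  then obtain i where i: "?m = Suc i" by (cases ?m) auto
  have le: "b ^ i * k \<le> n"
    using not_less_Least[of i "\<lambda>i. n < b ^ i * k"] i by simp
  have pos: "0 < primitive w k" "0 < primitive w n"
    using assms by (auto intro!: primitive_pos)
  have "primitive w n \<le> primitive w (b ^ Suc i * k)"
    using m i by (intro primitive_mono w) simp
  also have "\<dots> \<le> (real b / 2) ^ Suc i * primitive w k"
    by (rule URP_power[OF b(2,1) \<open>1 \<le> k\<close>])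
  also have "\<dots> \<le> real b ^ Suc i * primitive w k"
    using pos by (intro mult_right_mono power_mono) auto
  finally have "real k * primitive w n \<le> real k * (real b ^ Suc i * primitive w k)"
    by (intro mult_left_mono) auto
  also have "\<dots> = real b * real (b ^ i * k) * primitive w k"
    by simp
  also have "\<dots> \<le> real b * real n * primitive w k"
    using le pos by (intro mult_right_mono mult_left_mono) (auto simp del: of_nat_mult of_nat_power)
  finally show ?thesis
    using pos by (simp add: dual_seq_def field_simps)
qed

text \<open>The running maximum of n/s_n is non-decreasing, hence a primitive sequence, and by
  almost monotonicity it exceeds n/s_n at most by the factor \<open>b\<close>.\<close>

lemma dual_weight_exists:
  assumes w: "weight w" and "URP (primitive w)"
  shows "\<exists>w'. weight w' \<and> equivalent_seq (primitive w') (dual_seq (primitive w))"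
proof -
  let ?D = "dual_seq (primitive w)"
  obtain b where b: "2 \<le> b" "\<forall>n\<ge>1. primitive w (b * n) \<le> real b / 2 * primitive w n"
    using assms(2) by (auto simp: URP_def)
  have D: "0 < ?D n" if "1 \<le> n" for n
    using that primitive_pos[OF w that] by (simp add: dual_seq_def)
  \<comment> \<open>The value 0 at index 0 is the empty sum, so that the increments of
    \<open>T\<close> telescope to \<open>T\<close> exactly.\<close>
  define T where "T n = (if n = 0 then 0 else Max (?D ` {1..n}))" for n
  have T_ge: "?D k \<le> T n" if "1 \<le> k" "k \<le> n" for k n
    using that by (auto simp: T_def)
  have T_le: "T n \<le> real b * ?D n" if "1 \<le> n" for n
    using that dual_seq_almost_mono[OF w b] by (auto simp: T_def)
  have mono: "T n \<le> T (Suc n)" for n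
  proof (cases "n = 0")
    case True
    then show ?thesis using D[of 1] T_ge[of 1 "Suc n"] by (simp add: T_def)
  next
    case False
    then show ?thesis unfolding T_def by (auto intro!: Max_mono)
  qed
  define w' where "w' n = T (Suc n) - T n" for n
  have prim: "primitive w' = T"
  proof
    fix n
    have "T 0 = 0" by (simp add: T_def)
    then show "primitive w' n = T n"
      by (simp add: primitive_def w'_def sum_lessThan_telescope)
  qed
  have "weight w'"
    using mono D[of 1] by (auto simp: weight_def w'_def T_def)
  moreover have "equivalent_seq (primitive w') ?D"
  proof -
    have "1 \<le> T n / ?D n \<and> T n / ?D n \<le> real b" if "1 \<le> n" for n
      using T_ge[of n n] T_le[of n] D[of n] that by (simp add: divide_le_eq)
    then show ?thesis
      unfolding equivalent_seq_def prim using zero_less_one by blast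
  qed
  ultimately show ?thesis by blast
qed

lemma regular_weights_exist:
  assumes w: "weight w" and "URP (primitive w)" "LRP (primitive w)"
    and w': "weight w'" and "equivalent_seq (primitive w') (dual_seq (primitive w))"
    and q: "1 < q" "q' = q / (q - 1)"
  shows "\<exists>B K K' A. dual_regular_weights w w' B K K' q q' A"
proof -
  let ?s = "primitive w" and ?t = "primitive w'" and ?D = "dual_seq (primitive w)"
  obtain a where a: "2 \<le> a" "\<forall>n\<ge>1. 2 * ?s n \<le> ?s (a * n)"
    using assms(3) by (auto simp: LRP_def)
  obtain b where b: "2 \<le> b" "\<forall>n\<ge>1. ?s (b * n) \<le> real b / 2 * ?s n"
    using assms(2) by (auto simp: URP_def)
  obtain c C where c: "0 < c" and cC: "\<forall>n\<ge>1. c \<le> ?t n / ?D n \<and> ?t n / ?D n \<le> C"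
    using assms(5) by (auto simp: equivalent_seq_def)
  have s: "0 < ?s n" if "1 \<le> n" for n by (rule primitive_pos[OF w that])
  have D: "0 < ?D n" if "1 \<le> n" for n
    using that s[OF that] by (simp add: dual_seq_def)
  have t_ge: "c * ?D n \<le> ?t n" and t_le: "?t n \<le> C * ?D n" if "1 \<le> n" for n
    using cC[rule_format, OF that] D[OF that] by (auto simp: field_simps)
  have C: "0 < C"
    using cC[rule_format, of 1] c by linarith
  \<comment> \<open>With B = b^k, the bound by \<open>a\<close> gives \<open>a \<le> B\<close>, so
    that LRP and monotonicity double the primitive sequence of \<open>w\<close> from n to B n. The
    bound by 2 C / c lets the growth 2^k of n/s_n outweigh the equivalence constants, so that the
    primitive sequence of \<open>w'\<close> doubles too.\<close>
  obtain k where k: "max (real a) (2 * C / c) < 2 ^ k"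
    using real_arch_pow[of 2 "max (real a) (2 * C / c)"] by (auto simp del: max_less_iff_conj)
  define B where "B = b ^ k"
  have "2 ^ k \<le> real B"
    using b(1) by (simp add: B_def power_mono)
  then have "a \<le> B" using k by simp
  then have B2: "2 \<le> B" using a(1) by simp
  have pow: "1 \<le> B ^ j" for j using B2 by simp
  define K where "K = (real b / 2) ^ k"
  have upper: "?s (B * n) \<le> K * ?s n" if "1 \<le> n" for n
    unfolding B_def K_def by (rule URP_power[OF b(2,1) that])
  have K: "0 < K" "real B = 2 ^ k * K"
    using b(1) by (auto simp: K_def B_def power_divide)
  have X: "regular_weight w B K"
  proof
    show "2 * ?s (B ^ j) \<le> ?s (B ^ Suc j)" for j
    proof -
      have "2 * ?s (B ^ j) \<le> ?s (a * B ^ j)" using a(2) pow by blast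
      also have "\<dots> \<le> ?s (B ^ Suc j)" using \<open>a \<le> B\<close> by (intro primitive_mono w) simp
      finally show ?thesis .
    qed
    show "?s (B ^ Suc j) \<le> K * ?s (B ^ j)" for j
      using upper[OF pow] by simp
  qed (use w B2 in auto)
  have D_ge: "2 ^ k * ?D n \<le> ?D (B * n)" if "1 \<le> n" for n
  proof -
    have Bn: "1 \<le> B * n" using that B2 by simp
    have "2 ^ k * ?D n = real B * real n / (K * ?s n)"
      using K s[OF that] by (simp add: dual_seq_def)
    also have "\<dots> \<le> real B * real n / ?s (B * n)"
      using upper[OF that] s[OF Bn] K s[OF that] by (intro divide_left_mono) auto
    finally show ?thesis by (simp add: dual_seq_def)
  qed
  have D_le: "?D (B * n) \<le> real B * ?D n" if "1 \<le> n" for n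
  proof -
    have "n \<le> B * n" using B2 by simp
    then have "?s n \<le> ?s (B * n)" by (intro primitive_mono w)
    then show ?thesis
      using s[OF that] by (auto simp: dual_seq_def intro!: divide_left_mono mult_pos_pos)
  qed
  \<comment> \<open>As the primitive sequence of \<open>w\<close> is non-decreasing, n/s_n grows at
    most by the factor \<open>B\<close> from n to B n; C / c is the loss from the
    equivalence.\<close>
  have Y: "regular_weight w' B (C * real B / c)"
  proof
    fix j
    have Bj: "1 \<le> B * B ^ j" using pow[of "Suc j"] by simp
    have "2 * ?t (B ^ j) \<le> 2 * C * ?D (B ^ j)"
      using t_le[OF pow[of j]] by simp
    also have "\<dots> \<le> (2 ^ k * c) * ?D (B ^ j)"
      using k c D[OF pow[of j]] by (intro mult_right_mono) (auto simp: field_simps)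
    also have "\<dots> \<le> c * ?D (B * B ^ j)"
      using mult_left_mono[OF D_ge[OF pow[of j]], of c] c by (simp add: mult_ac)
    also have "\<dots> \<le> ?t (B * B ^ j)"
      by (rule t_ge[OF Bj])
    finally show "2 * ?t (B ^ j) \<le> ?t (B ^ Suc j)" by simp
    have "?t (B * B ^ j) \<le> C * ?D (B * B ^ j)"
      by (rule t_le[OF Bj])
    also have "\<dots> \<le> C * (real B * ?D (B ^ j))"
      using C by (intro mult_left_mono D_le pow) auto
    also have "\<dots> \<le> C * (real B * (?t (B ^ j) / c))"
      using C c t_ge[OF pow[of j]] by (intro mult_left_mono) (auto simp: field_simps)
    finally show "?t (B ^ Suc j) \<le> C * real B / c * ?t (B ^ j)" by simp
  qed (use w' B2 in auto)
  \<comment> \<open>The product of s_n and n/s_n is n, so S_j S'_j lies between c B^j and C B^j; the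
    maximum provides one constant for both directions.\<close>
  have "dual_regular_weights w w' B K (C * real B / c) q q' (max (1 / c) C)"
  proof (rule dual_regular_weights.intro[OF X Y], unfold_locales)
    fix j
    let ?n = "B ^ j"
    have ge: "c * real ?n \<le> ?s ?n * ?t ?n" and le: "?s ?n * ?t ?n \<le> C * real ?n"
      using mult_left_mono[OF t_ge[OF pow[of j]], of "?s ?n"]
        mult_left_mono[OF t_le[OF pow[of j]], of "?s ?n"] s[OF pow[of j]]
      by (auto simp: dual_seq_def mult_ac)
    have prod: "0 \<le> ?s ?n * ?t ?n"
      using ge c by (meson mult_nonneg_nonneg less_imp_le of_nat_0_le_iff order_trans)
    have "real ?n \<le> 1 / c * (?s ?n * ?t ?n)"
      using ge c by (simp add: field_simps)
    also have "\<dots> \<le> max (1 / c) C * (?s ?n * ?t ?n)"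
      using prod by (intro mult_right_mono) auto
    finally show "real ?n \<le> max (1 / c) C * (?s ?n * ?t ?n)" .
    show "?s ?n * ?t ?n \<le> max (1 / c) C * real ?n"
      by (rule order_trans[OF le]) (intro mult_right_mono, auto)
  qed (use q C in auto)
  then show ?thesis by blast
qed

text \<open>The dual weight is determined only up to equivalence of primitive sequences, so duality
  is asserted for every admissible choice; the existence part keeps this from being vacuous.\<close>

theorem theorem3p10:
  fixes q q' :: real and w :: "nat \<Rightarrow> real"
  assumes "1 < q" and "q' = q / (q - 1)"
    and "weight w" and "URP (primitive w)" and "LRP (primitive w)"
  shows "(\<exists>w'. weight w' \<and> equivalent_seq (primitive w') (dual_seq (primitive w))) \<and>
    (\<forall>w'. weight w' \<and> equivalent_seq (primitive w') (dual_seq (primitive w)) \<longrightarrow>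
       dual_is (lorentz_space q w :: (nat \<Rightarrow> 'a::{real_normed_field,banach}) set) (lorentz_norm q w)
               (lorentz_space q' w') (lorentz_norm q' w'))"
proof (intro conjI allI impI)
  show "\<exists>w'. weight w' \<and> equivalent_seq (primitive w') (dual_seq (primitive w))"
    using assms by (intro dual_weight_exists)
  fix w'
  assume "weight w' \<and> equivalent_seq (primitive w') (dual_seq (primitive w))"
  then obtain B K K' A where "dual_regular_weights w w' B K K' q q' A"
    using regular_weights_exist[of w w' q q'] assms by blast
  then show "dual_is (lorentz_space q w :: (nat \<Rightarrow> 'a) set) (lorentz_norm q w)
      (lorentz_space q' w') (lorentz_norm q' w')"
    by (rule dual_regular_weights.dual_is_lorentz)
qed

end
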